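(* Suppose that the vector space $L^1=L^1(\Omega,\mathcal F,\mathbb P)$ is separable. Then the cone $\mathcal A$ is countably strongly time-consistent, i.e. there exists a countable set $U\subset\mathcal N$ such that $\mathcal A$ is strongly $U$-time-consistent.
   Context: Let $T\ge1$ be an integer and $(\Omega,\mathcal F,(\mathcal F_t)_{t=0,\dots,T},\mathbb P)$ a filtered probability space with $\mathcal F=\mathcal F_T$ ($\mathcal F_0$ is not necessarily trivial). $L^\infty$, $L^1$ are taken with respect to $\mathbb P$ (and $\mathcal F$ unless another $\sigma$-algebra is indicated); a subscript $+$ denotes non-negative elements. Weak$^*$ means $\sigma(L^\infty,L^1)$. Fix a relevant coherent risk measure with the Fatou property $\rho:L^\infty\to\mathbb R$ (pricing sign convention), i.e.: $X\le Y$ implies $\rho(X)\le\rho(Y)$; $\rho(X+Y)\le\rho(X)+\rho(Y)$; $\rho(X+c)=\rho(X)+c$ for $c\in\mathbb R$; $\rho(aX)=a\rho(X)$ for real $a\ge0$; $\rho(X)\le\liminf_n\rho(X_n)$ whenever $(X_n)$ is uniformly bounded by $1$ and $X_n\to X$ in probability; $\rho(1_F)>0$ whenever $\mathbb P(F)>0$. Acceptance set: $\mathcal A=\{X\in L^\infty:\rho(X)\le0\}$. Polar: $\mathcal A^*=\{Z\in L^1:\mathbb E(ZX)\le0\ \forall X\in\mathcal A\}$. Test probabilities: $\mathcal Q=\{\mathbb Q\ll\mathbb P:\ d\mathbb Q/d\mathbb P\in\mathcal A^*\}$. For each $t$, $\mathcal A_t=\{X\in L^\infty:\mathbb E_{\mathbb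 Q}(X\mid\mathcal F_t)\le0\ \mathbb Q\text{-a.s. for all }\mathbb Q\in\mathcal Q\}$, $\mathcal N_t=\{v\in L^\infty_+: L^\infty=\mathcal A_t+L^\infty(\mathcal F_t)v\}$ and $\mathcal N=\bigcap_{t=0}^T\mathcal N_t$ (the numéraires). For $v\in\mathcal N$, $\rho_t^v(X)=\operatorname{ess\,inf}\{m\in L^\infty(\mathcal F_t):X-mv\in\mathcal A_t\}$. For $U\subset\mathcal N$, $\mathcal A$ is strongly $U$-time-consistent if for all $v\in U$, $t\in\{0,\dots,T-1\}$ and $X\in L^\infty$ there exist sequences $X_n\in L^\infty$, $Y^n_t\in L^\infty(\mathcal F_t;\mathbb R^n)$ and vectors $V^n=(v^1,\dots,v^n)$ with entries in $U$ such that: (i) $X_n\to X$ weakly$^*$ in $L^\infty$; (ii) $X_n-Y^n_t\cdot V^n\in\mathcal A_{t+1}$; (iii) $\rho_t^v(X)=\liminf_{n\to\infty}\rho_t^v(Y^n_t\cdot V^n)$. *)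

theory Defs
  imports "HOL-Probability.Probability"
begin

text \<open>
  Elements of \<open>L\<^sup>\<infinity>\<close> and \<open>L\<^sup>1\<close> are represented by functions, not by classes modulo almost sure
  equality; all relations between them are therefore stated almost everywhere, and every set of
  random variables below is closed under modification on null sets within its \<open>\<sigma>\<close>-algebra.
  \<open>Linf M G\<close> is \<open>L\<^sup>\<infinity>(G)\<close> with respect to the probability on \<open>M\<close>, for a sub-\<open>\<sigma>\<close>-algebra \<open>G\<close> of \<open>M\<close>;
  only \<open>space G\<close> and \<open>sets G\<close> matter.
\<close>

definition Linf :: "'a measure \<Rightarrow> 'a measure \<Rightarrow> ('a \<Rightarrow> real) set" where
  "Linf M G = {X \<in> borel_measurable G. \<exists>C. AE \<omega> in M. \<bar>X \<omega>\<bar> \<le> C}"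

definition L1 :: "'a measure \<Rightarrow> ('a \<Rightarrow> real) set" where
  "L1 M = {Z. integrable M Z}"

definition separable_L1 :: "'a measure \<Rightarrow> bool" where
  "separable_L1 M \<longleftrightarrow>
     (\<exists>D. countable D \<and> D \<subseteq> L1 M \<and>
        (\<forall>Z\<in>L1 M. \<forall>e>0. \<exists>W\<in>D. (\<integral>\<omega>. \<bar>Z \<omega> - W \<omega>\<bar> \<partial>M) < e))"

definition converges_in_probability ::
  "'a measure \<Rightarrow> (nat \<Rightarrow> 'a \<Rightarrow> real) \<Rightarrow> ('a \<Rightarrow> real) \<Rightarrow> bool" where
  "converges_in_probability M Xs X \<longleftrightarrow>
     (\<forall>e>0. (\<lambda>n. measure M {\<omega> \<in> space M. \<bar>Xs n \<omega> - X \<omega>\<bar> > e}) \<longlonglongrightarrow> 0)"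

definition weak_star_converges ::
  "'a measure \<Rightarrow> (nat \<Rightarrow> 'a \<Rightarrow> real) \<Rightarrow> ('a \<Rightarrow> real) \<Rightarrow> bool" where
  "weak_star_converges M Xs X \<longleftrightarrow>
     (\<forall>Z\<in>L1 M. (\<lambda>n. \<integral>\<omega>. Z \<omega> * Xs n \<omega> \<partial>M) \<longlonglongrightarrow> (\<integral>\<omega>. Z \<omega> * X \<omega> \<partial>M))"

definition finite_horizon_filtration ::
  "'a measure \<Rightarrow> (nat \<Rightarrow> 'a measure) \<Rightarrow> nat \<Rightarrow> bool" where
  "finite_horizon_filtration M F T \<longleftrightarrow>
     (\<forall>t\<le>T. subalgebra M (F t)) \<and>
     (\<forall>s t. s \<le> t \<and> t \<le> T \<longrightarrow> sets (F s) \<subseteq> sets (F t)) \<and>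
     sets (F T) = sets M"

text \<open>Monotonicity forces \<open>\<rho>\<close> to respect almost sure equality on \<open>L\<^sup>\<infinity>\<close>.\<close>

definition coherent_risk_measure :: "'a measure \<Rightarrow> (('a \<Rightarrow> real) \<Rightarrow> real) \<Rightarrow> bool" where
  "coherent_risk_measure M \<rho> \<longleftrightarrow>
     (\<forall>X\<in>Linf M M. \<forall>Y\<in>Linf M M. (AE \<omega> in M. X \<omega> \<le> Y \<omega>) \<longrightarrow> \<rho> X \<le> \<rho> Y) \<and>
     (\<forall>X\<in>Linf M M. \<forall>Y\<in>Linf M M. \<rho> (\<lambda>\<omega>. X \<omega> + Y \<omega>) \<le> \<rho> X + \<rho> Y) \<and>
     (\<forall>X\<in>Linf M M. \<forall>c. \<rho> (\<lambda>\<omega>. X \<omega> + c) = \<rho> X + c) \<and>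
     (\<forall>X\<in>Linf M M. \<forall>a\<ge>0. \<rho> (\<lambda>\<omega>. a * X \<omega>) = a * \<rho> X)"

definition fatou_property :: "'a measure \<Rightarrow> (('a \<Rightarrow> real) \<Rightarrow> real) \<Rightarrow> bool" where
  "fatou_property M \<rho> \<longleftrightarrow>
     (\<forall>Xs. \<forall>X\<in>Linf M M.
        (\<forall>n. Xs n \<in> Linf M M \<and> (AE \<omega> in M. \<bar>Xs n \<omega>\<bar> \<le> 1)) \<and>
        converges_in_probability M Xs X \<longrightarrow>
        ereal (\<rho> X) \<le> liminf (\<lambda>n. ereal (\<rho> (Xs n))))"

definition relevant :: "'a measure \<Rightarrow> (('a \<Rightarrow> real) \<Rightarrow> real) \<Rightarrow> bool" where
  "relevant M \<rho> \<longleftrightarrow> (\<forall>A\<in>sets M. measure M A > 0 \<longrightarrow> \<rho> (indicator A) > 0)"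

definition acceptance_set :: "'a measure \<Rightarrow> (('a \<Rightarrow> real) \<Rightarrow> real) \<Rightarrow> ('a \<Rightarrow> real) set" where
  "acceptance_set M \<rho> = {X \<in> Linf M M. \<rho> X \<le> 0}"

definition polar :: "'a measure \<Rightarrow> ('a \<Rightarrow> real) set \<Rightarrow> ('a \<Rightarrow> real) set" where
  "polar M A = {Z \<in> L1 M. \<forall>X\<in>A. (\<integral>\<omega>. Z \<omega> * X \<omega> \<partial>M) \<le> 0}"

definition test_probs :: "'a measure \<Rightarrow> ('a \<Rightarrow> real) set \<Rightarrow> 'a measure set" where
  "test_probs M A =
     {Q. prob_space Q \<and> sets Q = sets M \<and> absolutely_continuous M Q \<and>
         (\<lambda>\<omega>. enn2real (RN_deriv M Q \<omega>)) \<in> polar M A}"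

definition accept_at ::
  "'a measure \<Rightarrow> (nat \<Rightarrow> 'a measure) \<Rightarrow> ('a \<Rightarrow> real) set \<Rightarrow> nat \<Rightarrow> ('a \<Rightarrow> real) set" where
  "accept_at M F A t =
     {X \<in> Linf M M. \<forall>Q\<in>test_probs M A. AE \<omega> in Q. real_cond_exp Q (F t) X \<omega> \<le> 0}"

definition numeraires_at ::
  "'a measure \<Rightarrow> (nat \<Rightarrow> 'a measure) \<Rightarrow> ('a \<Rightarrow> real) set \<Rightarrow> nat \<Rightarrow> ('a \<Rightarrow> real) set" where
  "numeraires_at M F A t =
     {v \<in> Linf M M. (AE \<omega> in M. 0 \<le> v \<omega>) \<and>
        Linf M M = {\<lambda>\<omega>. X \<omega> + m \<omega> * v \<omega> | X m. X \<in> accept_at M F A t \<and> m \<in> Linf M (F t)}}"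

definition numeraires ::
  "'a measure \<Rightarrow> (nat \<Rightarrow> 'a measure) \<Rightarrow> nat \<Rightarrow> ('a \<Rightarrow> real) set \<Rightarrow> ('a \<Rightarrow> real) set" where
  "numeraires M F T A = (\<Inter>t\<in>{..T}. numeraires_at M F A t)"

text \<open>
  The essential infimum of an arbitrary family is its greatest lower bound modulo null sets among
  extended-real random variables. Over a probability space it exists for every family of random
  variables and is almost surely unique, so \<open>ess_inf\<close> merely selects a version; for families of
  \<open>F\<^sub>t\<close>-measurable functions it agrees almost surely with the one computed among
  \<open>F\<^sub>t\<close>-measurable functions.
\<close>

definition is_ess_inf :: "'a measure \<Rightarrow> ('a \<Rightarrow> real) set \<Rightarrow> ('a \<Rightarrow> ereal) \<Rightarrow> bool" where
  "is_ess_inf M S r \<longleftrightarrow>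
     r \<in> borel_measurable M \<and>
     (\<forall>m\<in>S. AE \<omega> in M. r \<omega> \<le> ereal (m \<omega>)) \<and>
     (\<forall>g\<in>borel_measurable M.
        (\<forall>m\<in>S. AE \<omega> in M. g \<omega> \<le> ereal (m \<omega>)) \<longrightarrow> (AE \<omega> in M. g \<omega> \<le> r \<omega>))"

definition ess_inf :: "'a measure \<Rightarrow> ('a \<Rightarrow> real) set \<Rightarrow> 'a \<Rightarrow> ereal" where
  "ess_inf M S = (SOME r. is_ess_inf M S r)"

definition cond_risk ::
  "'a measure \<Rightarrow> (nat \<Rightarrow> 'a measure) \<Rightarrow> ('a \<Rightarrow> real) set \<Rightarrow> ('a \<Rightarrow> real) \<Rightarrow> nat \<Rightarrow>
   ('a \<Rightarrow> real) \<Rightarrow> 'a \<Rightarrow> ereal" where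
  "cond_risk M F A v t X =
     ess_inf M {m \<in> Linf M (F t). (\<lambda>\<omega>. X \<omega> - m \<omega> * v \<omega>) \<in> accept_at M F A t}"

text \<open>
  The vectors are \<open>V\<^sup>n = (v\<^sup>1, \<dots>, v\<^sup>n)\<close>, the initial segments of one sequence \<open>V\<close> with entries in \<open>U\<close>;
  \<open>Y n i\<close> is the \<open>i\<close>-th coordinate of \<open>Y\<^sup>n\<^sub>t\<close>. Sequences are indexed by \<open>n \<ge> 1\<close>.
  Letting the entries of \<open>V\<^sup>n\<close> depend on \<open>n\<close> gives an equivalent notion: concatenate
  the vectors, pad with zero coefficients and repeat terms of the sequences.
\<close>

definition strongly_time_consistent ::
  "'a measure \<Rightarrow> (nat \<Rightarrow> 'a measure) \<Rightarrow> nat \<Rightarrow> ('a \<Rightarrow> real) set \<Rightarrow> ('a \<Rightarrow> real) set \<Rightarrow> bool" where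
  "strongly_time_consistent M F T A U \<longleftrightarrow>
     (\<forall>v\<in>U. \<forall>t<T. \<forall>X\<in>Linf M M.
        \<exists>(Xs :: nat \<Rightarrow> 'a \<Rightarrow> real) (Y :: nat \<Rightarrow> nat \<Rightarrow> 'a \<Rightarrow> real) (V :: nat \<Rightarrow> 'a \<Rightarrow> real).
          (\<forall>n\<ge>1. Xs n \<in> Linf M M) \<and>
          (\<forall>n\<ge>1. \<forall>i\<in>{1..n}. Y n i \<in> Linf M (F t)) \<and>
          (\<forall>i\<ge>1. V i \<in> U) \<and>
          weak_star_converges M Xs X \<and>
          (\<forall>n\<ge>1. (\<lambda>\<omega>. Xs n \<omega> - (\<Sum>i=1..n. Y n i \<omega> * V i \<omega>)) \<in> accept_at M F A (t + 1)) \<and>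
          (AE \<omega> in M. cond_risk M F A v t X \<omega> =
             liminf (\<lambda>n. cond_risk M F A v t (\<lambda>\<omega>'. \<Sum>i=1..n. Y n i \<omega>' * V i \<omega>') \<omega>)))"

text \<open>
  \<open>U\<close> is required to be non-empty, since strong \<open>{}\<close>-time-consistency holds vacuously.
\<close>

definition countably_strongly_time_consistent ::
  "'a measure \<Rightarrow> (nat \<Rightarrow> 'a measure) \<Rightarrow> nat \<Rightarrow> ('a \<Rightarrow> real) set \<Rightarrow> bool" where
  "countably_strongly_time_consistent M F T A \<longleftrightarrow>
     (\<exists>U. countable U \<and> U \<noteq> {} \<and> U \<subseteq> numeraires M F T A \<and> strongly_time_consistent M F T A U)"

end

(*
Every bounded v with v >= e > 0 is a numeraire, and each A_t is a solid, F_t-local cone that is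
closed under bounded almost sure limits. By separability, the elements of A_t of norm at most k
contain a countable L^1-dense set D_{t,k}, and U consists of 1 and of the numeraires d + k + 1
with d in D_{t,k}. Given X and v, put m = rho_t^v(X), so that X - m v lies in A_t, choose d_n in
some D_{t,k} with d_n -> X - m v almost surely, and put X_n = d_n + m v. This is an F_t-
combination of 1, v and d_n + k + 1, so X_n is its own hedge. Then rho_t^v(X_n) <= m, whereas
liminf rho_t^v(X_n) >= rho_t^v(X) by a conditional Fatou lemma. Where rho_t^v(X) = -oo, which
happens only on a set that is null under all test probabilities, m is truncated, and rho_t^v is
-oo for every position.
*)

theory Submission
  imports Defs
begin

text \<open>The obstacle is that \<open>U\<close> must be fixed before X, t and v are known, while
  L^infinity is in general not norm separable. Density in L^1 alone gives no uniform bound, so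
  approximation takes place inside norm balls of A_t: an almost surely convergent subsequence with a
  common bound then converges weakly* by dominated convergence. It is X - m v that is approximated,
  not X. The approximants lie in A_t, so the same m stays an admissible shift for every X_n; this
  yields the upper bound on the risk without any upper semicontinuity. The remaining part m v needs
  no approximation, because m is F_t-measurable and v itself belongs to \<open>U\<close>. The
  constant k + 1 lifts d >= -k to an instrument that is at least 1, hence a numeraire, and a
  constant position in the numeraire 1 takes it back.\<close>

section \<open>Bounded random variables modulo null sets\<close>

lemma LinfI:
  "X \<in> borel_measurable G \<Longrightarrow> (AE \<omega> in M. \<bar>X \<omega>\<bar> \<le> c) \<Longrightarrow> X \<in> Linf M G"
  by (auto simp: Linf_def)

lemma Linf_measurable: "X \<in> Linf M G \<Longrightarrow> X \<in> borel_measurable G"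
  by (simp add: Linf_def)

lemma Linf_bound:
  assumes "X \<in> Linf M G"
  obtains c where "0 \<le> c" "AE \<omega> in M. \<bar>X \<omega>\<bar> \<le> c"
proof -
  from assms obtain c where "AE \<omega> in M. \<bar>X \<omega>\<bar> \<le> c" by (auto simp: Linf_def)
  then have "AE \<omega> in M. \<bar>X \<omega>\<bar> \<le> max 0 c" by (auto elim!: eventually_mono)
  then show thesis by (rule that[rotated]) simp
qed

lemma Linf_const: "(\<lambda>_. c) \<in> Linf M G"
  by (auto simp: Linf_def)

lemma Linf_add:
  assumes "X \<in> Linf M G" "Y \<in> Linf M G"
  shows "(\<lambda>\<omega>. X \<omega> + Y \<omega>) \<in> Linf M G"
proof -
  from assms obtain c d where "AE \<omega> in M. \<bar>X \<omega>\<bar> \<le> c" "AE \<omega> in M. \<bar>Y \<omega>\<bar> \<le> d"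
    by (auto simp: Linf_def)
  then have "AE \<omega> in M. \<bar>X \<omega> + Y \<omega>\<bar> \<le> c + d" by eventually_elim linarith
  with assms show ?thesis by (auto simp: Linf_def)
qed

lemma Linf_mult:
  assumes "X \<in> Linf M G" "Y \<in> Linf M G"
  shows "(\<lambda>\<omega>. X \<omega> * Y \<omega>) \<in> Linf M G"
proof -
  obtain c d where "0 \<le> c" "AE \<omega> in M. \<bar>X \<omega>\<bar> \<le> c" "AE \<omega> in M. \<bar>Y \<omega>\<bar> \<le> d"
    by (metis Linf_bound[OF assms(1)] Linf_bound[OF assms(2)])
  from this(2,3) have "AE \<omega> in M. \<bar>X \<omega> * Y \<omega>\<bar> \<le> c * d"
  proof eventually_elim
    case (elim \<omega>)
    then show ?case using \<open>0 \<le> c\<close> by (auto simp: abs_mult intro!: mult_mono)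
  qed
  with assms show ?thesis by (auto simp: Linf_def)
qed

lemma Linf_diff:
  assumes "X \<in> Linf M G" "Y \<in> Linf M G"
  shows "(\<lambda>\<omega>. X \<omega> - Y \<omega>) \<in> Linf M G"
  using Linf_add[OF assms(1) Linf_mult[OF Linf_const[of "-1"] assms(2)]] by simp

lemma Linf_indicator: "B \<in> sets G \<Longrightarrow> indicator B \<in> Linf M G"
  by (rule LinfI[where c = 1]) (auto simp: indicator_def)

lemma Linf_subalgebra:
  assumes "subalgebra M G" "X \<in> Linf M G"
  shows "X \<in> Linf M M"
  using assms measurable_from_subalg[OF assms(1)] unfolding Linf_def by blast

lemma Linf_sum:
  "(\<And>i. i \<in> I \<Longrightarrow> X i \<in> Linf M G) \<Longrightarrow> (\<lambda>\<omega>. \<Sum>i\<in>I. X i \<omega>) \<in> Linf M G"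
proof (induction I rule: infinite_finite_induct)
  case (insert i I)
  then show ?case using Linf_add[of "X i" M G "\<lambda>\<omega>. \<Sum>i\<in>I. X i \<omega>"] by simp
qed (simp_all add: Linf_const)

lemma (in prob_space) Linf_integrable: "X \<in> Linf M M \<Longrightarrow> integrable M X"
  using integrable_const_bound[of X] by (auto simp: Linf_def)

section \<open>Acceptance sets tested by integrals\<close>

lemma test_prob_AE:
  assumes "Q \<in> test_probs M A" "AE \<omega> in M. P \<omega>"
  shows "AE \<omega> in Q. P \<omega>"
proof (rule absolutely_continuous_AE)
  show "sets Q = sets M" "absolutely_continuous M Q"
    using assms(1) by (simp_all add: test_probs_def)
qed fact

lemma test_prob_integrable:
  fixes M :: "'a measure"
  assumes "Q \<in> test_probs M A" "X \<in> Linf M M"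
  shows "integrable Q X"
proof -
  interpret Q: prob_space Q using assms(1) by (simp add: test_probs_def)
  from assms(2) obtain c where c: "AE \<omega> in M. \<bar>X \<omega>\<bar> \<le> c" by (auto simp: Linf_def)
  have "sets Q = sets M" using assms(1) by (simp add: test_probs_def)
  then have "borel_measurable Q = (borel_measurable M :: ('a \<Rightarrow> real) set)"
    by (rule measurable_cong_sets) simp
  then have "X \<in> borel_measurable Q" using Linf_measurable[OF assms(2)] by simp
  then show ?thesis using test_prob_AE[OF assms(1) c] by (intro Q.Linf_integrable LinfI)
qed

text \<open>The sign of a conditional expectation is determined by integrals over the conditioning
  sets. In this form the closure properties of the acceptance set follow from elementary facts about
  integrals.\<close>

lemma accept_at_iff:
  assumes "subalgebra M (F t)"
  shows "X \<in> accept_at M F A t \<longleftrightarrow> X \<in> Linf M M \<and>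
    (\<forall>Q\<in>test_probs M A. \<forall>B\<in>sets (F t). (\<integral>\<omega>. indicator B \<omega> * X \<omega> \<partial>Q) \<le> 0)"
proof -
  have "(AE \<omega> in Q. real_cond_exp Q (F t) X \<omega> \<le> 0) \<longleftrightarrow>
      (\<forall>B\<in>sets (F t). (\<integral>\<omega>. indicator B \<omega> * X \<omega> \<partial>Q) \<le> 0)"
    if X: "X \<in> Linf M M" and Q: "Q \<in> test_probs M A" for Q
  proof -
    interpret Q: prob_space Q using Q by (simp add: test_probs_def)
    have setsQ: "sets Q = sets M" using Q by (simp add: test_probs_def)
    have "subalgebra Q (F t)"
      using assms setsQ sets_eq_imp_space_eq[OF setsQ] by (simp add: subalgebra_def)
    then interpret Q: finite_measure_subalgebra Q "F t"
      by unfold_locales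
    let ?E = "real_cond_exp Q (F t) X"
    have intX: "integrable Q X" by (rule test_prob_integrable[OF Q X])
    have intE: "integrable Q ?E" by (rule Q.real_cond_exp_int(1)[OF intX])
    have eq: "(\<integral>\<omega>. indicator B \<omega> * X \<omega> \<partial>Q) = (\<integral>\<omega>. indicator B \<omega> * ?E \<omega> \<partial>Q)"
      if "B \<in> sets (F t)" for B
      using Q.real_cond_exp_intA[OF intX that] by (simp add: set_lebesgue_integral_def)
    show ?thesis
    proof
      assume "AE \<omega> in Q. ?E \<omega> \<le> 0"
      then have "AE \<omega> in Q. 0 \<le> - (indicator B \<omega> * ?E \<omega>)" for B
        by eventually_elim (simp add: indicator_def)
      from integral_nonneg_AE[OF this]
      have "(\<integral>\<omega>. indicator B \<omega> * ?E \<omega> \<partial>Q) \<le> 0" for B by simp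
      then show "\<forall>B\<in>sets (F t). (\<integral>\<omega>. indicator B \<omega> * X \<omega> \<partial>Q) \<le> 0" by (simp add: eq)
    next
      assume *: "\<forall>B\<in>sets (F t). (\<integral>\<omega>. indicator B \<omega> * X \<omega> \<partial>Q) \<le> 0"
      \<comment> \<open>The extremal test set: the integral of \<open>?E\<close> over it is both
        nonnegative and nonpositive, hence zero, so \<open>B\<close> is null under
        \<open>Q\<close>.\<close>
      define B where "B = {\<omega> \<in> space (F t). 0 < ?E \<omega>}"
      have B: "B \<in> sets (F t)" unfolding B_def by measurable
      then have BQ: "B \<in> sets Q" using Q.subalg by (auto simp: subalgebra_def)
      have spc: "space (F t) = space Q" using Q.subalg by (simp add: subalgebra_def)
      have nn: "AE \<omega> in Q. 0 \<le> indicator B \<omega> * ?E \<omega>" by (auto simp: B_def indicator_def)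
      have int: "integrable Q (\<lambda>\<omega>. indicator B \<omega> * ?E \<omega>)"
        using integrable_mult_indicator[OF BQ intE] by simp
      have "(\<integral>\<omega>. indicator B \<omega> * ?E \<omega> \<partial>Q) = 0"
        using bspec[OF * B] integral_nonneg_AE[OF nn] unfolding eq[OF B] by (rule antisym)
      then have "AE \<omega> in Q. indicator B \<omega> * ?E \<omega> = 0"
        using integral_nonneg_eq_0_iff_AE[OF int nn] by simp
      then show "AE \<omega> in Q. ?E \<omega> \<le> 0"
        using AE_space by eventually_elim (auto simp: B_def indicator_def spc split: if_splits)
    qed
  qed
  then show ?thesis by (simp add: accept_at_def cong: conj_cong)
qed

text \<open>These closure properties are all that the analysis of the conditional risk uses; the
  test probabilities do not appear in it. \<open>paste\<close> is locality in \<open>G\<close>, and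
  \<open>limit\<close> is a sequential substitute for weak* closedness.\<close>

locale conditional_acceptance = prob_space M for M :: "'a measure" +
  fixes G :: "'a measure" and A :: "('a \<Rightarrow> real) set"
  assumes subalg: "subalgebra M G"
    and Linf: "X \<in> A \<Longrightarrow> X \<in> Linf M M"
    and zero: "(\<lambda>_. 0) \<in> A"
    and mono: "X \<in> A \<Longrightarrow> Y \<in> Linf M M \<Longrightarrow> AE \<omega> in M. Y \<omega> \<le> X \<omega> \<Longrightarrow> Y \<in> A"
    and scale: "X \<in> A \<Longrightarrow> 0 \<le> a \<Longrightarrow> (\<lambda>\<omega>. a * X \<omega>) \<in> A"
    and paste: "X \<in> A \<Longrightarrow> Y \<in> A \<Longrightarrow> B \<in> sets G \<Longrightarrow> (\<lambda>\<omega>. if \<omega> \<in> B then X \<omega> else Y \<omega>) \<in> A"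
    and limit: "(\<And>n::nat. Xs n \<in> A) \<Longrightarrow> X \<in> Linf M M \<Longrightarrow> (\<And>n. AE \<omega> in M. \<bar>Xs n \<omega>\<bar> \<le> c) \<Longrightarrow>
      AE \<omega> in M. (\<lambda>n. Xs n \<omega>) \<longlonglongrightarrow> X \<omega> \<Longrightarrow> X \<in> A"

text \<open>Each property is checked on integrals over F_t-sets, with almost sure statements carried
  from \<open>M\<close> to \<open>Q\<close> by absolute continuity. Pasting works because both
  pieces of a test set cut by \<open>B\<close> are again F_t-sets; limits are handled by dominated
  convergence.\<close>

lemma conditional_acceptance_accept_at:
  assumes "prob_space M" and sub: "subalgebra M (F t)"
  shows "conditional_acceptance M (F t) (accept_at M F A t)"
proof -
  interpret prob_space M by fact
  note iff = accept_at_iff[where F = F and t = t and A = A, OF sub]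
  have subD: "B \<in> sets M" if "B \<in> sets (F t)" for B
    using that sub by (auto simp: subalgebra_def)
  have int: "integrable Q (\<lambda>\<omega>. indicator B \<omega> * X \<omega>)"
    if "Q \<in> test_probs M A" "B \<in> sets (F t)" "X \<in> Linf M M" for Q B X
    using test_prob_integrable[OF that(1) Linf_mult[OF Linf_indicator[OF subD[OF that(2)]] that(3)]] .
  show ?thesis
  proof
    show "subalgebra M (F t)" by fact
    show "X \<in> Linf M M" if "X \<in> accept_at M F A t" for X
      using that by (simp add: accept_at_def)
    show "(\<lambda>_. 0) \<in> accept_at M F A t" by (simp add: iff Linf_const)
    show "Y \<in> accept_at M F A t"
      if X: "X \<in> accept_at M F A t" and Y: "Y \<in> Linf M M" and le: "AE \<omega> in M. Y \<omega> \<le> X \<omega>" for X Y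
      unfolding iff
    proof (intro conjI ballI Y)
      fix Q B assume Q: "Q \<in> test_probs M A" and B: "B \<in> sets (F t)"
      have "AE \<omega> in Q. indicator B \<omega> * Y \<omega> \<le> indicator B \<omega> * X \<omega>"
        using test_prob_AE[OF Q le] by eventually_elim (auto simp: indicator_def)
      then have "(\<integral>\<omega>. indicator B \<omega> * Y \<omega> \<partial>Q) \<le> (\<integral>\<omega>. indicator B \<omega> * X \<omega> \<partial>Q)"
        using X int[OF Q B] Y by (intro integral_mono_AE) (auto simp: iff)
      also have "\<dots> \<le> 0" using X Q B by (simp add: iff)
      finally show "(\<integral>\<omega>. indicator B \<omega> * Y \<omega> \<partial>Q) \<le> 0" .
    qed
    show "(\<lambda>\<omega>. a * X \<omega>) \<in> accept_at M F A t"
      if X: "X \<in> accept_at M F A t" and a: "0 \<le> a" for X a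
    proof -
      have "(\<integral>\<omega>. indicator B \<omega> * (a * X \<omega>) \<partial>Q) = a * (\<integral>\<omega>. indicator B \<omega> * X \<omega> \<partial>Q)" for B Q
        by (subst mult.left_commute) (rule integral_mult_right_zero)
      then show ?thesis
        using X a Linf_mult[OF Linf_const, of X M M a] by (simp add: iff mult_nonneg_nonpos)
    qed
    show "(\<lambda>\<omega>. if \<omega> \<in> B then X \<omega> else Y \<omega>) \<in> accept_at M F A t" (is "?Z \<in> _")
      if X: "X \<in> accept_at M F A t" and Y: "Y \<in> accept_at M F A t" and B: "B \<in> sets (F t)" for X Y B
    proof -
      have eq: "indicator C \<omega> * ?Z \<omega> = indicator (C \<inter> B) \<omega> * X \<omega> + indicator (C - B) \<omega> * Y \<omega>" for C \<omega>
        by (simp add: indicator_def)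
      have "?Z = (\<lambda>\<omega>. indicator B \<omega> * X \<omega> + (1 - indicator B \<omega>) * Y \<omega>)"
        by (auto simp: indicator_def)
      then have Z: "?Z \<in> Linf M M"
        using X Y subD[OF B] by (auto simp: iff intro!: Linf_add Linf_mult Linf_diff Linf_const Linf_indicator)
      show ?thesis unfolding iff
      proof (intro conjI ballI Z)
        fix Q C assume Q: "Q \<in> test_probs M A" and C: "C \<in> sets (F t)"
        have "(\<integral>\<omega>. indicator C \<omega> * ?Z \<omega> \<partial>Q) =
            (\<integral>\<omega>. indicator (C \<inter> B) \<omega> * X \<omega> \<partial>Q) + (\<integral>\<omega>. indicator (C - B) \<omega> * Y \<omega> \<partial>Q)"
          unfolding eq using X Y B C int[OF Q] by (intro Bochner_Integration.integral_add) (auto simp: iff)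
        also have "\<dots> \<le> 0" using X Y B C Q by (intro add_nonpos_nonpos) (auto simp: iff)
        finally show "(\<integral>\<omega>. indicator C \<omega> * ?Z \<omega> \<partial>Q) \<le> 0" .
      qed
    qed
    show "X \<in> accept_at M F A t"
      if Xs: "\<And>n::nat. Xs n \<in> accept_at M F A t" and X: "X \<in> Linf M M"
        and c: "\<And>n. AE \<omega> in M. \<bar>Xs n \<omega>\<bar> \<le> c" and lim: "AE \<omega> in M. (\<lambda>n. Xs n \<omega>) \<longlonglongrightarrow> X \<omega>" for Xs X c
      unfolding iff
    proof (intro conjI ballI X)
      fix Q B assume Q: "Q \<in> test_probs M A" and B: "B \<in> sets (F t)"
      interpret Q: prob_space Q using Q by (simp add: test_probs_def)
      have "(\<lambda>n. \<integral>\<omega>. indicator B \<omega> * Xs n \<omega> \<partial>Q) \<longlonglongrightarrow> (\<integral>\<omega>. indicator B \<omega> * X \<omega> \<partial>Q)"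
      proof (rule integral_dominated_convergence[where w = "\<lambda>_. c"])
        show "(\<lambda>\<omega>. indicator B \<omega> * X \<omega>) \<in> borel_measurable Q"
          using int[OF Q B X] by simp
        show "(\<lambda>\<omega>. indicator B \<omega> * Xs n \<omega>) \<in> borel_measurable Q" for n
          using int[OF Q B] Xs by (simp add: iff)
        show "AE \<omega> in Q. (\<lambda>n. indicator B \<omega> * Xs n \<omega>) \<longlonglongrightarrow> indicator B \<omega> * X \<omega>"
          using test_prob_AE[OF Q lim] by eventually_elim (intro tendsto_intros)
        show "AE \<omega> in Q. norm (indicator B \<omega> * Xs n \<omega>) \<le> c" for n
          using test_prob_AE[OF Q c[of n]] by eventually_elim (auto simp: indicator_def)
      qed simp
      then show "(\<integral>\<omega>. indicator B \<omega> * X \<omega> \<partial>Q) \<le> 0"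
        using Xs Q B by (intro LIMSEQ_le_const2) (auto simp: iff)
    qed
  qed
qed

section \<open>Essential infima of downward directed families\<close>

text \<open>The classical argument minimizes the integral of a bounded, strictly increasing
  transform. \<open>arctan\<close> keeps the integrals finite without any bound on the family;
  running minima of a minimizing sequence then decrease to the essential infimum.\<close>

lemma (in prob_space) directed_ess_inf_sequence:
  assumes S: "S \<noteq> {}" "S \<subseteq> borel_measurable M"
    and min: "\<And>m m'. m \<in> S \<Longrightarrow> m' \<in> S \<Longrightarrow> (\<lambda>\<omega>. min (m \<omega>) (m' \<omega>)) \<in> S"
  obtains f :: "nat \<Rightarrow> 'a \<Rightarrow> real"
  where "\<And>n. f n \<in> S" "\<And>\<omega>. decseq (\<lambda>n. f n \<omega>)" "is_ess_inf M S (\<lambda>\<omega>. INF n. ereal (f n \<omega>))"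
proof -
  define \<phi> where "\<phi> m = (\<integral>\<omega>. arctan (m \<omega>) \<partial>M)" for m
  define \<alpha> where "\<alpha> = Inf (\<phi> ` S)"
  have meas[measurable]: "m \<in> borel_measurable M" if "m \<in> S" for m using S that by auto
  have arctan_measurable[measurable]: "(\<lambda>\<omega>. arctan (m \<omega>)) \<in> borel_measurable M"
    if "m \<in> borel_measurable M" for m :: "'a \<Rightarrow> real"
    using that by (intro borel_measurable_continuous_on[OF continuous_on_arctan[OF continuous_on_id]]) auto
  have bound: "\<bar>arctan x\<bar> \<le> 2" for x
    using arctan_lbound[of x] arctan_ubound[of x] pi_less_4 by linarith
  have int: "integrable M (\<lambda>\<omega>. arctan (m \<omega>))" if "m \<in> borel_measurable M" for m
    using that bound by (intro integrable_const_bound[where B = 2]) auto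
  have \<phi>_bound: "-2 \<le> \<phi> m" if "m \<in> S" for m
  proof -
    have "- 2 \<le> arctan (m \<omega>)" for \<omega> using bound[of "m \<omega>"] by linarith
    then show ?thesis
      using integral_ge_const[OF int[OF meas[OF that]], of "-2"] by (simp add: \<phi>_def)
  qed
  have bdd: "bdd_below (\<phi> ` S)" using \<phi>_bound by (auto intro: bdd_belowI[of _ "-2"])
  have le: "\<alpha> \<le> \<phi> m" if "m \<in> S" for m
    unfolding \<alpha>_def using that bdd by (auto intro: cInf_lower)
  have "\<exists>m\<in>S. \<phi> m < \<alpha> + inverse (Suc n)" for n
    using cInf_lessD[of "\<phi> ` S" "\<alpha> + inverse (Suc n)"] S(1) by (auto simp: \<alpha>_def)
  then obtain h where h: "\<And>n. h n \<in> S" "\<And>n. \<phi> (h n) < \<alpha> + inverse (Suc n)" by metis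
  define f where "f = rec_nat (h 0) (\<lambda>n g \<omega>. min (g \<omega>) (h (Suc n) \<omega>))"
  have f0: "f 0 = h 0" and fS: "f (Suc n) = (\<lambda>\<omega>. min (f n \<omega>) (h (Suc n) \<omega>))" for n
    by (simp_all add: f_def)
  have f: "f n \<in> S" for n by (induction n) (auto simp: f0 fS h intro: min)
  have dec: "decseq (\<lambda>n. f n \<omega>)" for \<omega> by (rule decseq_SucI) (simp add: fS)
  have fh: "f n \<omega> \<le> h n \<omega>" for n \<omega> by (cases n) (simp_all add: f0 fS)
  have f_le: "AE \<omega> in M. (INF n. ereal (f n \<omega>)) \<le> ereal (m \<omega>)" if m: "m \<in> S" for m
  proof -
    \<comment> \<open>The amount by which \<open>m\<close> undercuts \<open>f n\<close>, on the
      \<open>arctan\<close> scale. The minimum stays in \<open>S\<close>, so its integral under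
      \<open>\<phi>\<close> is at least \<open>\<alpha>\<close>, and the mean of \<open>d n\<close>
      is at most the optimality gap of \<open>h n\<close>.\<close>
    define d where "d n \<omega> = arctan (f n \<omega>) - arctan (min (f n \<omega>) (m \<omega>))" for n \<omega>
    have dnn: "0 \<le> d n \<omega>" for n \<omega> by (simp add: d_def arctan_le_iff)
    have dint: "integrable M (d n)" for n
      unfolding d_def using f m by (intro Bochner_Integration.integrable_diff int) auto
    have d_le: "(\<integral>\<omega>. d n \<omega> \<partial>M) \<le> inverse (Suc n)" for n
    proof -
      have "(\<integral>\<omega>. d n \<omega> \<partial>M) = \<phi> (f n) - \<phi> (\<lambda>\<omega>. min (f n \<omega>) (m \<omega>))"
        unfolding d_def \<phi>_def using f m by (intro Bochner_Integration.integral_diff int) auto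
      moreover have "\<phi> (f n) \<le> \<phi> (h n)"
        unfolding \<phi>_def using f h fh by (intro integral_mono int) (auto simp: arctan_le_iff)
      ultimately show ?thesis using le[OF min[OF f m], of n] h(2)[of n] by linarith
    qed
    define e where "e \<omega> = lim (\<lambda>n. d n \<omega>)" for \<omega>
    have lim_e: "(\<lambda>n. d n \<omega>) \<longlonglongrightarrow> e \<omega>" for \<omega>
    proof -
      have dec': "decseq (\<lambda>n. arctan (f n \<omega>))" "decseq (\<lambda>n. arctan (min (f n \<omega>) (m \<omega>)))"
        using decseqD[OF dec[of \<omega>]] by (auto simp: decseq_def arctan_le_iff min.coboundedI1)
      have "convergent (\<lambda>n. arctan (g n))" if "decseq (\<lambda>n. arctan (g n))" for g :: "nat \<Rightarrow> real"
      proof -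
        have "- 2 \<le> arctan (g n)" for n using bound[of "g n"] by linarith
        then show ?thesis using decseq_convergent[OF that, of "-2"] unfolding convergent_def by metis
      qed
      from this[OF dec'(1)] this[OF dec'(2)]
      have "convergent (\<lambda>n. d n \<omega>)" unfolding d_def by (rule convergent_diff)
      then show ?thesis unfolding e_def by (simp add: convergent_LIMSEQ_iff)
    qed
    have [measurable]: "d n \<in> borel_measurable M" for n using dint[of n] by simp
    have emeas[measurable]: "e \<in> borel_measurable M" unfolding e_def by measurable
    have dbound: "\<bar>d n \<omega>\<bar> \<le> 4" for n \<omega>
      using bound[of "f n \<omega>"] bound[of "min (f n \<omega>) (m \<omega>)"] unfolding d_def by linarith
    have "(\<lambda>n. \<integral>\<omega>. d n \<omega> \<partial>M) \<longlonglongrightarrow> (\<integral>\<omega>. e \<omega> \<partial>M)"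
      using lim_e dbound by (intro integral_dominated_convergence[where w = "\<lambda>_. 4"]) auto
    moreover have "(\<lambda>n. \<integral>\<omega>. d n \<omega> \<partial>M) \<longlonglongrightarrow> 0"
      using d_le dnn by (intro tendsto_sandwich[OF _ _ tendsto_const LIMSEQ_inverse_real_of_nat]) auto
    ultimately have "(\<integral>\<omega>. e \<omega> \<partial>M) = 0" by (rule LIMSEQ_unique)
    moreover have enn: "0 \<le> e \<omega>" for \<omega> using LIMSEQ_le_const[OF lim_e] dnn by auto
    moreover have "\<bar>e \<omega>\<bar> \<le> 4" for \<omega>
      using LIMSEQ_le_const2[OF tendsto_rabs[OF lim_e]] dbound by auto
    then have "integrable M e" by (intro integrable_const_bound[where B = 4]) auto
    ultimately have "AE \<omega> in M. e \<omega> = 0" using integral_nonneg_eq_0_iff_AE[of M e] by simp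
    then show ?thesis
    proof eventually_elim
      case (elim \<omega>)
      show ?case
      proof (rule ccontr)
        assume "\<not> ?thesis"
        \<comment> \<open>A real \<open>z\<close> strictly between \<open>m\<close> and the infimum
          would keep every \<open>d n\<close> above the positive gap between \<open>arctan z\<close>
          and \<open>arctan (m \<omega>)\<close>, against \<open>e \<omega> = 0\<close>.\<close>
        then have "ereal (m \<omega>) < (INF n. ereal (f n \<omega>))" by simp
        then obtain y where y: "ereal (m \<omega>) < y" "y < (INF n. ereal (f n \<omega>))"
          using dense by blast
        then obtain z where z: "y = ereal z" by (cases y) auto
        have "z \<le> f n \<omega>" for n
        proof -
          have "y < ereal (f n \<omega>)"
            using y(2) INF_lower[of n UNIV "\<lambda>n. ereal (f n \<omega>)"] by (auto intro: less_le_trans)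
          then show ?thesis using z by simp
        qed
        then have "arctan z - arctan (m \<omega>) \<le> d n \<omega>" for n
          unfolding d_def by (intro diff_mono) (auto simp: arctan_le_iff)
        then have "arctan z - arctan (m \<omega>) \<le> e \<omega>" using LIMSEQ_le_const[OF lim_e] by auto
        with elim y(1) z show False by (simp add: arctan_le_iff)
      qed
    qed
  qed
  have "is_ess_inf M S (\<lambda>\<omega>. INF n. ereal (f n \<omega>))"
    unfolding is_ess_inf_def
  proof (intro conjI ballI impI f_le)
    show "(\<lambda>\<omega>. INF n. ereal (f n \<omega>)) \<in> borel_measurable M" using f by measurable
    fix g assume "\<forall>m\<in>S. AE \<omega> in M. g \<omega> \<le> ereal (m \<omega>)"
    then have "AE \<omega> in M. \<forall>n. g \<omega> \<le> ereal (f n \<omega>)" using f by (simp add: AE_all_countable)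
    then show "AE \<omega> in M. g \<omega> \<le> (INF n. ereal (f n \<omega>))"
      by eventually_elim (simp add: INF_greatest)
  qed
  with f dec show thesis by (rule that)
qed

section \<open>Conditional risk for a numeraire bounded away from zero\<close>

locale numeraire_acceptance = conditional_acceptance M G A
  for M :: "'a measure" and G :: "'a measure" and A :: "('a \<Rightarrow> real) set" +
  fixes v :: "'a \<Rightarrow> real" and e :: real
  assumes v_Linf: "v \<in> Linf M M" and e_pos: "0 < e" and v_ge: "AE \<omega> in M. e \<le> v \<omega>"
begin

definition shifts :: "('a \<Rightarrow> real) \<Rightarrow> ('a \<Rightarrow> real) set" where
  "shifts X = {m \<in> Linf M G. (\<lambda>\<omega>. X \<omega> - m \<omega> * v \<omega>) \<in> A}"

text \<open>This is \<open>cond_risk\<close> for a fixed date and numeraire, once \<open>G\<close>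
  and \<open>A\<close> are instantiated by \<open>F t\<close> and
  \<open>accept_at M F A t\<close>.\<close>

definition risk :: "('a \<Rightarrow> real) \<Rightarrow> 'a \<Rightarrow> ereal" where
  "risk X = ess_inf M (shifts X)"

lemma G_Linf: "m \<in> Linf M G \<Longrightarrow> m \<in> Linf M M"
  by (rule Linf_subalgebra[OF subalg])

lemma space_G: "space G = space M"
  using subalg by (simp add: subalgebra_def)

lemma shifts_Linf: "m \<in> shifts X \<Longrightarrow> m \<in> Linf M G"
  by (simp add: shifts_def)

lemma shift_Linf:
  assumes "X \<in> Linf M M" "m \<in> Linf M G"
  shows "(\<lambda>\<omega>. X \<omega> - m \<omega> * v \<omega>) \<in> Linf M M"
  by (rule Linf_diff[OF assms(1) Linf_mult[OF G_Linf[OF assms(2)] v_Linf]])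

text \<open>Since \<open>v\<close> is at least \<open>e\<close>, the position (c/e) v dominates c
  and hence X. This makes every set of shifts nonempty and gives an upper bound on the risk that is
  uniform over positions bounded by c.\<close>

lemma shifts_const:
  assumes X: "X \<in> Linf M M" and c: "AE \<omega> in M. \<bar>X \<omega>\<bar> \<le> c" "0 \<le> c"
  shows "(\<lambda>_. c / e) \<in> shifts X"
  unfolding shifts_def
proof (intro CollectI conjI)
  show "(\<lambda>\<omega>. X \<omega> - c / e * v \<omega>) \<in> A"
  proof (rule mono[OF zero])
    show "AE \<omega> in M. X \<omega> - c / e * v \<omega> \<le> 0"
      using c(1) v_ge
    proof eventually_elim
      case (elim \<omega>)
      have "c / e * e \<le> c / e * v \<omega>" using elim(2) c(2) e_pos by (intro mult_left_mono) auto
      with elim(1) e_pos show ?case by simp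
    qed
  qed (rule shift_Linf[OF X Linf_const])
qed (rule Linf_const)

lemma shifts_mono:
  assumes X: "X \<in> Linf M M" and m: "m \<in> shifts X"
    and m': "m' \<in> Linf M G" "AE \<omega> in M. m \<omega> \<le> m' \<omega>"
  shows "m' \<in> shifts X"
proof -
  have "AE \<omega> in M. X \<omega> - m' \<omega> * v \<omega> \<le> X \<omega> - m \<omega> * v \<omega>"
    using m'(2) v_ge
  proof eventually_elim
    case (elim \<omega>)
    then have "m \<omega> * v \<omega> \<le> m' \<omega> * v \<omega>" using e_pos by (intro mult_right_mono) auto
    then show ?case by simp
  qed
  moreover have "(\<lambda>\<omega>. X \<omega> - m \<omega> * v \<omega>) \<in> A" using m by (simp add: shifts_def)
  ultimately show ?thesis
    using mono[OF _ shift_Linf[OF X m'(1)]] m'(1) by (simp add: shifts_def)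
qed

text \<open>Locality makes the shifts downward directed: paste the two accepted positions along the
  \<open>G\<close>-set where \<open>m\<close> is the smaller shift.\<close>

lemma shifts_min:
  assumes X: "X \<in> Linf M M" and m: "m \<in> shifts X" "m' \<in> shifts X"
  shows "(\<lambda>\<omega>. min (m \<omega>) (m' \<omega>)) \<in> shifts X"
proof -
  note mL = shifts_Linf[OF m(1)] shifts_Linf[OF m(2)]
  note [measurable] = mL[THEN Linf_measurable]
  obtain c c' where "AE \<omega> in M. \<bar>m \<omega>\<bar> \<le> c" "AE \<omega> in M. \<bar>m' \<omega>\<bar> \<le> c'"
    using mL by (auto simp: Linf_def)
  then have "AE \<omega> in M. \<bar>min (m \<omega>) (m' \<omega>)\<bar> \<le> max c c'" by eventually_elim (auto simp: min_def)
  then have L: "(\<lambda>\<omega>. min (m \<omega>) (m' \<omega>)) \<in> Linf M G" by (intro LinfI) auto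
  define B where "B = {\<omega> \<in> space G. m \<omega> \<le> m' \<omega>}"
  have B: "B \<in> sets G" unfolding B_def by measurable
  have "(\<lambda>\<omega>. if \<omega> \<in> B then X \<omega> - m \<omega> * v \<omega> else X \<omega> - m' \<omega> * v \<omega>) \<in> A"
    using m by (intro paste B) (simp_all add: shifts_def)
  then have "(\<lambda>\<omega>. X \<omega> - min (m \<omega>) (m' \<omega>) * v \<omega>) \<in> A"
    by (rule mono[OF _ shift_Linf[OF X L]]) (simp add: B_def space_G min_def)
  with L show ?thesis by (simp add: shifts_def)
qed

lemma shifts_sequence:
  assumes X: "X \<in> Linf M M"
  obtains f :: "nat \<Rightarrow> 'a \<Rightarrow> real"
  where "\<And>n. f n \<in> shifts X" "\<And>\<omega>. decseq (\<lambda>n. f n \<omega>)"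
    "is_ess_inf M (shifts X) (\<lambda>\<omega>. INF n. ereal (f n \<omega>))"
proof (rule directed_ess_inf_sequence)
  obtain c where "AE \<omega> in M. \<bar>X \<omega>\<bar> \<le> c" "0 \<le> c" using Linf_bound[OF X] by metis
  then show "shifts X \<noteq> {}" using shifts_const[OF X] by blast
  show "shifts X \<subseteq> borel_measurable M"
    using Linf_measurable[OF G_Linf[OF shifts_Linf]] by blast
qed (use shifts_min[OF X] that in blast)+

text \<open>The choice operator inside \<open>ess_inf\<close> returns a genuine essential infimum
  because the infimum of a minimizing sequence is a witness.\<close>

lemma risk_is_ess_inf:
  assumes "X \<in> Linf M M"
  shows "is_ess_inf M (shifts X) (risk X)"
  unfolding risk_def ess_inf_def using shifts_sequence[OF assms] by (metis someI)

lemma risk_le: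
  "X \<in> Linf M M \<Longrightarrow> m \<in> shifts X \<Longrightarrow> AE \<omega> in M. risk X \<omega> \<le> ereal (m \<omega>)"
  using risk_is_ess_inf by (simp add: is_ess_inf_def)

lemma risk_greatest:
  assumes "X \<in> Linf M M" "g \<in> borel_measurable M"
    "\<And>m. m \<in> shifts X \<Longrightarrow> AE \<omega> in M. g \<omega> \<le> ereal (m \<omega>)"
  shows "AE \<omega> in M. g \<omega> \<le> risk X \<omega>"
  using risk_is_ess_inf[OF assms(1)] assms(2,3) by (simp add: is_ess_inf_def)

lemma risk_measurable: "X \<in> Linf M M \<Longrightarrow> risk X \<in> borel_measurable M"
  using risk_is_ess_inf by (simp add: is_ess_inf_def)

lemma risk_mono:
  assumes "X \<in> Linf M M" "Y \<in> Linf M M" "AE \<omega> in M. X \<omega> \<le> Y \<omega>"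
  shows "AE \<omega> in M. risk X \<omega> \<le> risk Y \<omega>"
proof (rule risk_greatest[OF assms(2) risk_measurable[OF assms(1)]])
  fix m assume m: "m \<in> shifts Y"
  have "AE \<omega> in M. X \<omega> - m \<omega> * v \<omega> \<le> Y \<omega> - m \<omega> * v \<omega>"
    using assms(3) by eventually_elim simp
  moreover have "(\<lambda>\<omega>. Y \<omega> - m \<omega> * v \<omega>) \<in> A" using m by (simp add: shifts_def)
  ultimately have "m \<in> shifts X"
    using mono[OF _ shift_Linf[OF assms(1) shifts_Linf[OF m]]] shifts_Linf[OF m]
    by (simp add: shifts_def)
  then show "AE \<omega> in M. risk X \<omega> \<le> ereal (m \<omega>)" by (rule risk_le[OF assms(1)])
qed

text \<open>The risk may be unbounded below and so need not be a shift itself. Cut off at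
  \<open>k\<close>, the decreasing minimizing sequence is uniformly bounded, and closedness of
  \<open>A\<close> makes its limit admissible: the truncated risk is attained.\<close>

lemma risk_truncated_shift:
  assumes X: "X \<in> Linf M M"
  obtains m where "m \<in> shifts X" "AE \<omega> in M. ereal (m \<omega>) = max (risk X \<omega>) (ereal k)"
proof -
  obtain f :: "nat \<Rightarrow> 'a \<Rightarrow> real" where f: "\<And>n. f n \<in> shifts X" "\<And>\<omega>. decseq (\<lambda>n. f n \<omega>)"
    and inf: "is_ess_inf M (shifts X) (\<lambda>\<omega>. INF n. ereal (f n \<omega>))"
    using shifts_sequence[OF X] by blast
  have eq: "AE \<omega> in M. risk X \<omega> = (INF n. ereal (f n \<omega>))"
  proof -
    have "AE \<omega> in M. risk X \<omega> \<le> (INF n. ereal (f n \<omega>))"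
      "AE \<omega> in M. (INF n. ereal (f n \<omega>)) \<le> risk X \<omega>"
      using inf risk_is_ess_inf[OF X] by (simp_all add: is_ess_inf_def)
    then show ?thesis by eventually_elim simp
  qed
  define g where "g n \<omega> = max (f n \<omega>) k" for n \<omega>
  define m where "m \<omega> = lim (\<lambda>n. g n \<omega>)" for \<omega>
  have dec: "decseq (\<lambda>n. g n \<omega>)" for \<omega>
    using decseqD[OF f(2)] by (simp add: g_def decseq_def max.coboundedI1)
  have lim: "(\<lambda>n. g n \<omega>) \<longlonglongrightarrow> m \<omega>" for \<omega>
  proof -
    have "\<forall>n. k \<le> g n \<omega>" by (simp add: g_def)
    with dec[of \<omega>] have "convergent (\<lambda>n. g n \<omega>)"
      using decseq_convergent[of "\<lambda>n. g n \<omega>" k] unfolding convergent_def by metis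
    then show ?thesis unfolding m_def by (simp add: convergent_LIMSEQ_iff)
  qed
  have [measurable]: "f n \<in> borel_measurable G" for n
    using f(1) shifts_Linf Linf_measurable by blast
  have [measurable]: "g n \<in> borel_measurable G" for n unfolding g_def by measurable
  have m_meas[measurable]: "m \<in> borel_measurable G" unfolding m_def by measurable
  obtain c where c: "AE \<omega> in M. \<bar>f 0 \<omega>\<bar> \<le> c"
    using f(1)[of 0] by (auto simp: shifts_def Linf_def)
  \<comment> \<open>The first term bounds the decreasing sequence from above; the truncation level
    bounds it from below.\<close>
  define K where "K = max c \<bar>k\<bar>"
  have gK: "AE \<omega> in M. \<bar>g n \<omega>\<bar> \<le> K" for n
    using c
  proof eventually_elim
    case (elim \<omega>)
    have "g n \<omega> \<le> g 0 \<omega>" using decseqD[OF dec, of 0 n] by simp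
    moreover have "k \<le> g n \<omega>" by (simp add: g_def)
    ultimately show ?case using elim by (simp add: g_def K_def)
  qed
  have gL: "g n \<in> Linf M G" for n using gK by (intro LinfI) auto
  have gS: "g n \<in> shifts X" for n
    by (rule shifts_mono[OF X f(1)[of n] gL]) (simp add: g_def)
  have "AE \<omega> in M. \<forall>n. \<bar>g n \<omega>\<bar> \<le> K" using gK by (simp add: AE_all_countable)
  then have "AE \<omega> in M. \<bar>m \<omega>\<bar> \<le> K"
    by eventually_elim (rule LIMSEQ_le_const2[OF tendsto_rabs[OF lim]], auto)
  then have mL: "m \<in> Linf M G" by (intro LinfI) auto
  obtain b where b: "0 \<le> b" "AE \<omega> in M. \<bar>v \<omega>\<bar> \<le> b" using Linf_bound[OF v_Linf] by metis
  obtain x where x: "AE \<omega> in M. \<bar>X \<omega>\<bar> \<le> x" using Linf_bound[OF X] by metis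
  have "(\<lambda>\<omega>. X \<omega> - m \<omega> * v \<omega>) \<in> A"
  proof (rule limit)
    show "(\<lambda>\<omega>. X \<omega> - g n \<omega> * v \<omega>) \<in> A" for n using gS by (simp add: shifts_def)
    show "(\<lambda>\<omega>. X \<omega> - m \<omega> * v \<omega>) \<in> Linf M M" by (rule shift_Linf[OF X mL])
    show "AE \<omega> in M. \<bar>X \<omega> - g n \<omega> * v \<omega>\<bar> \<le> x + K * b" for n
      using gK[of n] b(2) x
    proof eventually_elim
      case (elim \<omega>)
      have "\<bar>g n \<omega> * v \<omega>\<bar> \<le> K * b"
        unfolding abs_mult using elim by (intro mult_mono) auto
      with elim(3) show ?case by linarith
    qed
    show "AE \<omega> in M. (\<lambda>n. X \<omega> - g n \<omega> * v \<omega>) \<longlonglongrightarrow> X \<omega> - m \<omega> * v \<omega>"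
      by (intro AE_I2 tendsto_intros lim)
  qed
  with mL have "m \<in> shifts X" by (simp add: shifts_def)
  moreover have "AE \<omega> in M. ereal (m \<omega>) = max (risk X \<omega>) (ereal k)"
    using eq
  proof eventually_elim
    case (elim \<omega>)
    have "decseq (\<lambda>n. ereal (f n \<omega>))" using f(2)[of \<omega>] by (simp add: decseq_def)
    then have "(\<lambda>n. ereal (f n \<omega>)) \<longlonglongrightarrow> risk X \<omega>" unfolding elim by (rule LIMSEQ_INF)
    then have "(\<lambda>n. max (ereal (f n \<omega>)) (ereal k)) \<longlonglongrightarrow> max (risk X \<omega>) (ereal k)"
      by (intro tendsto_max tendsto_const)
    moreover have "(\<lambda>n. max (ereal (f n \<omega>)) (ereal k)) \<longlonglongrightarrow> ereal (m \<omega>)"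
      using tendsto_ereal[OF lim[of \<omega>]] by (simp add: g_def)
    ultimately show ?case by (rule LIMSEQ_unique[symmetric])
  qed
  ultimately show thesis by (rule that)
qed

text \<open>The lower envelopes of the tails increase to X and lie below the later
  \<open>Z j\<close>. Their attained truncated risks increase to some \<open>\<mu>\<close>, and
  closedness of \<open>A\<close> makes \<open>\<mu>\<close> a shift for X, so the risk of X is at
  most the limit of the risks of the envelopes.\<close>

lemma risk_fatou:
  assumes Z: "\<And>j. Z j \<in> Linf M M" "\<And>j. AE \<omega> in M. \<bar>Z j \<omega>\<bar> \<le> c" and X: "X \<in> Linf M M"
    and conv: "AE \<omega> in M. (\<lambda>j. Z j \<omega>) \<longlonglongrightarrow> X \<omega>"
  shows "AE \<omega> in M. risk X \<omega> \<le> liminf (\<lambda>j. risk (Z j) \<omega>)"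
proof -
  define d where "d = \<bar>c\<bar>"
  \<comment> \<open>The bound on \<open>Z j\<close> holds only almost surely, whereas a real infimum
    needs a lower bound at every point. Clipping provides it and changes \<open>Z j\<close> only on
    a null set.\<close>
  define Z' where "Z' j \<omega> = max (- d) (min d (Z j \<omega>))" for j \<omega>
  define w where "w n \<omega> = (INF j\<in>{n..}. Z' j \<omega>)" for n \<omega>
  have d: "0 \<le> d" by (simp add: d_def)
  have Z'_bound: "- d \<le> Z' j \<omega>" "Z' j \<omega> \<le> d" for j \<omega> using d by (auto simp: Z'_def)
  have bdd: "bdd_below ((\<lambda>j. Z' j \<omega>) ` I)" for \<omega> I using Z'_bound(1) by (intro bdd_belowI2)
  have w_le: "w n \<omega> \<le> Z' j \<omega>" if "n \<le> j" for n j \<omega>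
    unfolding w_def using that by (intro cINF_lower bdd) auto
  have w_ge: "y \<le> w n \<omega>" if "\<And>j. n \<le> j \<Longrightarrow> y \<le> Z' j \<omega>" for y n \<omega>
    unfolding w_def using that by (intro cINF_greatest) auto
  have w_bound: "\<bar>w n \<omega>\<bar> \<le> d" for n \<omega>
    using w_ge[of n "- d" \<omega>] w_le[of n n \<omega>] Z'_bound[of _ \<omega>] by (simp add: abs_le_iff) (meson minus_le_iff order_trans)
  have w_inc: "w n \<omega> \<le> w (Suc n) \<omega>" for n \<omega> by (rule w_ge) (simp add: w_le)
  have [measurable]: "Z j \<in> borel_measurable M" for j using Z(1) by (rule Linf_measurable)
  have [measurable]: "Z' j \<in> borel_measurable M" for j unfolding Z'_def by measurable
  have wm: "w n \<in> borel_measurable M" for n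
    unfolding w_def by (rule borel_measurable_cINF) (auto intro: bdd)
  have wL: "w n \<in> Linf M M" for n using w_bound by (intro LinfI[OF wm]) auto
  have Z_eq: "AE \<omega> in M. \<forall>j. Z' j \<omega> = Z j \<omega>"
    unfolding AE_all_countable
  proof
    fix j show "AE \<omega> in M. Z' j \<omega> = Z j \<omega>"
      using Z(2)[of j] by eventually_elim (auto simp: Z'_def d_def)
  qed
  have w_lim: "AE \<omega> in M. (\<lambda>n. w n \<omega>) \<longlonglongrightarrow> X \<omega>"
    using Z_eq conv
  proof eventually_elim
    case (elim \<omega>)
    show ?case
    proof (rule LIMSEQ_I)
      fix r :: real assume r: "0 < r"
      then obtain N where N: "\<And>j. N \<le> j \<Longrightarrow> \<bar>Z' j \<omega> - X \<omega>\<bar> < r / 2"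
        using LIMSEQ_D[OF elim(2), of "r / 2"] elim(1) by auto
      have "norm (w n \<omega> - X \<omega>) < r" if n: "N \<le> n" for n
      proof -
        have "X \<omega> - r / 2 \<le> w n \<omega>"
        proof (rule w_ge)
          fix j assume "n \<le> j"
          then have "\<bar>Z' j \<omega> - X \<omega>\<bar> < r / 2" using N n by simp
          then show "X \<omega> - r / 2 \<le> Z' j \<omega>" by linarith
        qed
        moreover have "w n \<omega> \<le> Z' n \<omega>" by (simp add: w_le)
        ultimately show ?thesis using N[OF n] r unfolding real_norm_def by linarith
      qed
      then show "\<exists>N. \<forall>n\<ge>N. norm (w n \<omega> - X \<omega>) < r" by blast
    qed
  qed
  obtain b where b: "0 \<le> b" "AE \<omega> in M. \<bar>v \<omega>\<bar> \<le> b" using Linf_bound[OF v_Linf] by metis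
  \<comment> \<open>The level \<open>k\<close> is fixed here so that the risks of the envelopes are
    attained by bounded shifts; it is removed afterwards.\<close>
  have main: "AE \<omega> in M. risk X \<omega> \<le> liminf (\<lambda>j. max (risk (Z j) \<omega>) (ereal k))" for k
  proof -
    have "\<exists>m. m \<in> shifts (w n) \<and> (AE \<omega> in M. ereal (m \<omega>) = max (risk (w n) \<omega>) (ereal k))" for n
      using risk_truncated_shift[OF wL] by blast
    then obtain m where m: "\<And>n. m n \<in> shifts (w n)"
      "\<And>n. AE \<omega> in M. ereal (m n \<omega>) = max (risk (w n) \<omega>) (ereal k)" by metis
    \<comment> \<open>\<open>d / e\<close> is the constant shift that works for every position
      bounded by \<open>d\<close>, and \<open>\<bar>k\<bar>\<close> accounts for the
      truncation.\<close>
    define K where "K = max (d / e) \<bar>k\<bar>"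
    define \<mu> where "\<mu> \<omega> = lim (\<lambda>n. m n \<omega>)" for \<omega>
    have [measurable]: "m n \<in> borel_measurable G" for n
      using m(1) shifts_Linf Linf_measurable by blast
    have \<mu>_meas: "\<mu> \<in> borel_measurable G" unfolding \<mu>_def by measurable
    have m_eq: "AE \<omega> in M. \<forall>n. ereal (m n \<omega>) = max (risk (w n) \<omega>) (ereal k)"
      using m(2) by (simp add: AE_all_countable)
    have r_bound: "AE \<omega> in M. \<forall>n. risk (w n) \<omega> \<le> ereal (d / e)"
      unfolding AE_all_countable using w_bound d
      by (intro allI risk_le[OF wL] shifts_const[OF wL]) auto
    have r_inc: "AE \<omega> in M. \<forall>n. risk (w n) \<omega> \<le> risk (w (Suc n)) \<omega>"
      unfolding AE_all_countable using w_inc by (intro allI risk_mono wL) auto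
    have r_Z: "AE \<omega> in M. \<forall>n j. n \<le> j \<longrightarrow> risk (w n) \<omega> \<le> risk (Z j) \<omega>"
      unfolding AE_all_countable
    proof (intro allI)
      fix n j
      show "AE \<omega> in M. n \<le> j \<longrightarrow> risk (w n) \<omega> \<le> risk (Z j) \<omega>"
      proof (cases "n \<le> j")
        case True
        have "AE \<omega> in M. w n \<omega> \<le> Z j \<omega>"
          using Z_eq by eventually_elim (metis True w_le)
        then show ?thesis using True risk_mono[OF wL Z(1)] by simp
      qed simp
    qed
    have m_bound: "AE \<omega> in M. \<forall>n. \<bar>m n \<omega>\<bar> \<le> K"
      using m_eq r_bound
    proof eventually_elim
      case (elim \<omega>)
      show ?case
      proof
        fix n
        have "d / e \<le> K" "k \<le> K" by (auto simp: K_def)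
        then have "ereal (d / e) \<le> ereal K" "ereal k \<le> ereal K" by simp_all
        then have "ereal (m n \<omega>) \<le> ereal K"
          using elim(1)[rule_format, of n] order_trans[OF elim(2)[rule_format, of n]] by simp
        moreover have "ereal k \<le> ereal (m n \<omega>)" using elim(1)[rule_format, of n] by simp
        ultimately have "m n \<omega> \<le> K" "k \<le> m n \<omega>" by simp_all
        then show "\<bar>m n \<omega>\<bar> \<le> K" unfolding K_def by linarith
      qed
    qed
    have m_lim: "AE \<omega> in M. (\<lambda>n. m n \<omega>) \<longlonglongrightarrow> \<mu> \<omega> \<and> (\<forall>n. m n \<omega> \<le> \<mu> \<omega>)"
      using m_eq r_inc m_bound
    proof eventually_elim
      case (elim \<omega>)
      have "ereal (m n \<omega>) \<le> ereal (m (Suc n) \<omega>)" for n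
        using elim(1,2) by (simp add: max.coboundedI1)
      then have inc: "incseq (\<lambda>n. m n \<omega>)" by (intro incseq_SucI) simp
      moreover have "\<forall>n. m n \<omega> \<le> K" using elim(3) by (simp add: abs_le_iff)
      ultimately obtain l where "(\<lambda>n. m n \<omega>) \<longlonglongrightarrow> l" by (rule incseq_convergent)
      then have "(\<lambda>n. m n \<omega>) \<longlonglongrightarrow> \<mu> \<omega>" by (simp add: \<mu>_def limI)
      with incseq_le[OF inc this] show ?case by blast
    qed
    have "AE \<omega> in M. \<bar>\<mu> \<omega>\<bar> \<le> K"
      using m_lim m_bound
      by eventually_elim (rule LIMSEQ_le_const2[OF tendsto_rabs], auto)
    then have \<mu>L: "\<mu> \<in> Linf M G" by (intro LinfI[OF \<mu>_meas]) auto
    have "(\<lambda>\<omega>. X \<omega> - \<mu> \<omega> * v \<omega>) \<in> A"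
    proof (rule limit)
      show "(\<lambda>\<omega>. w n \<omega> - m n \<omega> * v \<omega>) \<in> A" for n using m(1) by (simp add: shifts_def)
      show "(\<lambda>\<omega>. X \<omega> - \<mu> \<omega> * v \<omega>) \<in> Linf M M" by (rule shift_Linf[OF X \<mu>L])
      show "AE \<omega> in M. \<bar>w n \<omega> - m n \<omega> * v \<omega>\<bar> \<le> d + K * b" for n
        using m_bound b(2)
      proof eventually_elim
        case (elim \<omega>)
        have "\<bar>m n \<omega> * v \<omega>\<bar> \<le> K * b"
          unfolding abs_mult using elim by (intro mult_mono) (auto simp: K_def)
        with w_bound[of n \<omega>] show ?case by linarith
      qed
      show "AE \<omega> in M. (\<lambda>n. w n \<omega> - m n \<omega> * v \<omega>) \<longlonglongrightarrow> X \<omega> - \<mu> \<omega> * v \<omega>"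
        using m_lim w_lim by eventually_elim (intro tendsto_intros, auto)
    qed
    with \<mu>L have "AE \<omega> in M. risk X \<omega> \<le> ereal (\<mu> \<omega>)"
      by (intro risk_le[OF X]) (simp add: shifts_def)
    then show ?thesis using m_lim m_eq r_Z
    proof eventually_elim
      case (elim \<omega>)
      have le: "ereal (m n \<omega>) \<le> liminf (\<lambda>j. max (risk (Z j) \<omega>) (ereal k))" for n
      proof (rule Liminf_bounded)
        show "\<forall>\<^sub>F j in sequentially. ereal (m n \<omega>) \<le> max (risk (Z j) \<omega>) (ereal k)"
          using eventually_ge_at_top[of n]
          by eventually_elim (use elim(3,4) in \<open>simp add: max.coboundedI1\<close>)
      qed
      have "(\<lambda>n. ereal (m n \<omega>)) \<longlonglongrightarrow> ereal (\<mu> \<omega>)" using elim(2) by simp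
      then have "ereal (\<mu> \<omega>) \<le> liminf (\<lambda>j. max (risk (Z j) \<omega>) (ereal k))"
        by (rule LIMSEQ_le_const2) (use le in blast)
      with elim(1) show ?case by (rule order_trans)
    qed
  qed
  then have "AE \<omega> in M. \<forall>k::nat. risk X \<omega> \<le> liminf (\<lambda>j. max (risk (Z j) \<omega>) (ereal (- real k)))"
    by (simp add: AE_all_countable)
  then show ?thesis
  proof eventually_elim
    case (elim \<omega>)
    \<comment> \<open>Choose a real level between \<open>y\<close> and the risk of X, and
      \<open>k\<close> so large that the truncation lies below this level. A truncated risk above
      the level is then exceeded by no truncation effect: the risk itself is above it.\<close>
    show ?case unfolding le_Liminf_iff
    proof (intro allI impI)
      fix y assume "y < risk X \<omega>"
      then obtain z where z: "y < z" "z < risk X \<omega>" using dense by blast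
      then obtain z' where z': "z = ereal z'" by (cases z) auto
      obtain k :: nat where "- z' \<le> real k" using real_arch_simple by blast
      then have k: "ereal (- real k) \<le> z" by (simp add: z')
      have "z < liminf (\<lambda>j. max (risk (Z j) \<omega>) (ereal (- real k)))"
        using z(2) elim less_le_trans by blast
      then have "\<forall>\<^sub>F j in sequentially. z < max (risk (Z j) \<omega>) (ereal (- real k))"
        by (rule less_LiminfD)
      then show "\<forall>\<^sub>F j in sequentially. y < risk (Z j) \<omega>"
        by eventually_elim (use z(1) k in \<open>auto simp: less_max_iff_disj\<close>)
    qed
  qed
qed

text \<open>Below the threshold \<open>-k\<close> one is on a set that is null under every test probability, where
  every position is acceptable.\<close>

lemma risk_below_threshold:
  assumes X: "X \<in> Linf M M"
  obtains k where "\<And>Y. Y \<in> Linf M M \<Longrightarrow>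
    AE \<omega> in M. risk X \<omega> < ereal (- k) \<longrightarrow> risk Y \<omega> = - \<infinity>"
proof -
  obtain c where c: "0 \<le> c" "AE \<omega> in M. \<bar>X \<omega>\<bar> \<le> c" using Linf_bound[OF X] by metis
  obtain b where b: "0 \<le> b" "AE \<omega> in M. \<bar>v \<omega>\<bar> \<le> b" using Linf_bound[OF v_Linf] by metis
  \<comment> \<open>Where \<open>m\<close> is at most \<open>- k\<close>, the accepted position X -
    m v is at least -c + k e = 1. By pasting with zero and monotonicity, the indicator of that set
    is then itself accepted.\<close>
  define k where "k = (c + 1) / e"
  obtain m where m: "m \<in> shifts X" "AE \<omega> in M. ereal (m \<omega>) = max (risk X \<omega>) (ereal (- k))"
    using risk_truncated_shift[OF X] by blast
  define C where "C = {\<omega> \<in> space G. m \<omega> \<le> - k}"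
  have [measurable]: "m \<in> borel_measurable G" using m(1) shifts_Linf Linf_measurable by blast
  have C: "C \<in> sets G" unfolding C_def by measurable
  then have CM: "C \<in> sets M" using subalg by (auto simp: subalgebra_def)
  have "(\<lambda>\<omega>. if \<omega> \<in> C then X \<omega> - m \<omega> * v \<omega> else 0) \<in> A"
    using m(1) by (intro paste C zero) (simp add: shifts_def)
  then have C_A: "indicator C \<in> A"
  proof (rule mono[OF _ Linf_indicator[OF CM]])
    show "AE \<omega> in M. indicator C \<omega> \<le> (if \<omega> \<in> C then X \<omega> - m \<omega> * v \<omega> else 0)"
      using c(2) v_ge
    proof eventually_elim
      case (elim \<omega>)
      have "1 \<le> X \<omega> - m \<omega> * v \<omega>" if "\<omega> \<in> C"
      proof -
        have "0 \<le> k" using c(1) e_pos by (simp add: k_def)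
        then have "k * e \<le> (- m \<omega>) * v \<omega>"
          using that elim(2) e_pos c(1) by (intro mult_mono) (auto simp: C_def)
        moreover have "k * e = c + 1" using e_pos by (simp add: k_def)
        ultimately show ?thesis using elim(1) by (simp add: abs_le_iff)
      qed
      then show ?case by simp
    qed
  qed
  have "AE \<omega> in M. risk X \<omega> < ereal (- k) \<longrightarrow> risk Y \<omega> = - \<infinity>" if Y: "Y \<in> Linf M M" for Y
  proof -
    obtain y where y: "0 \<le> y" "AE \<omega> in M. \<bar>Y \<omega>\<bar> \<le> y" using Linf_bound[OF Y] by metis
    have "AE \<omega> in M. \<omega> \<in> C \<longrightarrow> risk Y \<omega> \<le> ereal (- real n)" for n :: nat
    proof -
      \<comment> \<open>On \<open>C\<close> every nonnegative multiple of the indicator is accepted,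
        so a shift as low as \<open>- real n\<close> is admissible: Y + n v is at most y + n b
        there. Off \<open>C\<close> the constant shift \<open>y / e\<close> is used.\<close>
      define m' where "m' \<omega> = (if \<omega> \<in> C then - real n else y / e)" for \<omega>
      have "AE \<omega> in M. \<bar>m' \<omega>\<bar> \<le> max (real n) (y / e)"
        using y(1) e_pos by (auto simp: m'_def)
      moreover have "m' \<in> borel_measurable G" unfolding m'_def using C by measurable
      ultimately have m'L: "m' \<in> Linf M G" by (intro LinfI)
      have "(\<lambda>\<omega>. if \<omega> \<in> C then (y + real n * b) * indicator C \<omega> else Y \<omega> - y / e * v \<omega>) \<in> A"
        using shifts_const[OF Y y(2,1)] y(1) b(1) by (intro paste scale C_A C) (simp_all add: shifts_def)
      then have "(\<lambda>\<omega>. Y \<omega> - m' \<omega> * v \<omega>) \<in> A"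
      proof (rule mono[OF _ shift_Linf[OF Y m'L]])
        show "AE \<omega> in M. Y \<omega> - m' \<omega> * v \<omega> \<le>
            (if \<omega> \<in> C then (y + real n * b) * indicator C \<omega> else Y \<omega> - y / e * v \<omega>)"
          using y(2) b(2)
        proof eventually_elim
          case (elim \<omega>)
          have "real n * v \<omega> \<le> real n * b" using elim(2) by (intro mult_left_mono) auto
          then show ?case using elim(1) by (simp add: m'_def abs_le_iff)
        qed
      qed
      then have "AE \<omega> in M. risk Y \<omega> \<le> ereal (m' \<omega>)"
        using m'L by (intro risk_le[OF Y]) (simp add: shifts_def)
      then show ?thesis by eventually_elim (simp add: m'_def split: if_splits)
    qed
    then have "AE \<omega> in M. \<forall>n::nat. \<omega> \<in> C \<longrightarrow> risk Y \<omega> \<le> ereal (- real n)"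
      unfolding AE_all_countable by blast
    then show ?thesis using m(2) AE_space
    proof eventually_elim
      case (elim \<omega>)
      show ?case
      proof
        assume "risk X \<omega> < ereal (- k)"
        with elim(2,3) have "\<omega> \<in> C" by (simp add: C_def space_G max_def split: if_splits)
        with elim(1) have le: "risk Y \<omega> \<le> ereal (- real n)" for n :: nat by simp
        show "risk Y \<omega> = - \<infinity>"
        proof (rule ereal_bot)
          fix B :: real
          obtain n :: nat where "- B \<le> real n" using real_arch_simple by blast
          then have "ereal (- real n) \<le> ereal B" by simp
          with le show "risk Y \<omega> \<le> ereal B" by (rule order_trans)
        qed
      qed
    qed
  qed
  then show thesis by (rule that)
qed

end

section \<open>Approximation of a position by elements of a countable set\<close>

text \<open>The bound \<open>k\<close> and the coefficient \<open>m\<close> depend on X but not on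
  \<open>n\<close>: a common \<open>k\<close> gives the uniform bound, and a common \<open>m\<close>
  keeps the upper estimate of the risk fixed along the sequence.\<close>

lemma (in numeraire_acceptance) risk_approximation:
  assumes X: "X \<in> Linf M M"
    and D: "\<And>k::nat. D k \<subseteq> {W \<in> A. AE \<omega> in M. \<bar>W \<omega>\<bar> \<le> real k}"
    and dense: "\<And>(k::nat) Z r. Z \<in> A \<Longrightarrow> AE \<omega> in M. \<bar>Z \<omega>\<bar> \<le> real k \<Longrightarrow> 0 < r \<Longrightarrow>
      \<exists>W\<in>D k. (\<integral>\<omega>. \<bar>Z \<omega> - W \<omega>\<bar> \<partial>M) < r"
  obtains k m d c where "m \<in> Linf M G" "\<And>n::nat. d n \<in> D k"
    "\<And>n. AE \<omega> in M. \<bar>d n \<omega> + m \<omega> * v \<omega>\<bar> \<le> c"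
    "AE \<omega> in M. (\<lambda>n. d n \<omega> + m \<omega> * v \<omega>) \<longlonglongrightarrow> X \<omega>"
    "AE \<omega> in M. risk X \<omega> = liminf (\<lambda>n. risk (\<lambda>\<omega>. d n \<omega> + m \<omega> * v \<omega>) \<omega>)"
proof -
  obtain \<kappa> where \<kappa>: "\<And>Y. Y \<in> Linf M M \<Longrightarrow>
      AE \<omega> in M. risk X \<omega> < ereal (- \<kappa>) \<longrightarrow> risk Y \<omega> = - \<infinity>"
    using risk_below_threshold[OF X] by blast
  \<comment> \<open>Truncation at exactly this threshold loses nothing: above it \<open>m\<close>
    equals the risk of X, and below it all risks are minus infinity.\<close>
  obtain m where m: "m \<in> shifts X" and m_eq: "AE \<omega> in M. ereal (m \<omega>) = max (risk X \<omega>) (ereal (- \<kappa>))"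
    using risk_truncated_shift[OF X] by blast
  have mL: "m \<in> Linf M G" by (rule shifts_Linf[OF m])
  define X' where "X' \<omega> = X \<omega> - m \<omega> * v \<omega>" for \<omega>
  have X': "X' \<in> A" using m by (simp add: shifts_def X'_def[abs_def])
  obtain x where x: "AE \<omega> in M. \<bar>X' \<omega>\<bar> \<le> x" using Linf_bound[OF Linf[OF X']] by metis
  obtain k :: nat where "x \<le> real k" using real_arch_simple by blast
  with x have "AE \<omega> in M. \<bar>X' \<omega>\<bar> \<le> real k" by (auto elim: eventually_mono)
  then have "\<exists>W\<in>D k. (\<integral>\<omega>. \<bar>X' \<omega> - W \<omega>\<bar> \<partial>M) < inverse (Suc n)" for n
    by (intro dense[OF X']) auto
  then obtain d' where d': "\<And>n. d' n \<in> D k" "\<And>n. (\<integral>\<omega>. \<bar>X' \<omega> - d' n \<omega>\<bar> \<partial>M) < inverse (Suc n)"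
    by metis
  have d'L: "d' n \<in> Linf M M" for n using D d'(1) Linf by blast
  have "(\<lambda>n. \<integral>\<omega>. norm (X' \<omega> - d' n \<omega>) \<partial>M) \<longlonglongrightarrow> 0"
    using d'(2) by (intro tendsto_sandwich[OF _ _ tendsto_const LIMSEQ_inverse_real_of_nat])
      (auto intro!: always_eventually less_imp_le)
  \<comment> \<open>Convergence in mean is upgraded to almost sure convergence along a subsequence,
    as the Fatou lemma requires.\<close>
  then obtain r where r: "strict_mono r" "AE \<omega> in M. (\<lambda>n. X' \<omega> - d' (r n) \<omega>) \<longlonglongrightarrow> 0"
    using tendsto_L1_AE_subseq[of M "\<lambda>n \<omega>. X' \<omega> - d' n \<omega>"] Linf_integrable[OF Linf_diff[OF Linf[OF X'] d'L]]
    by blast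
  define d where "d n = d' (r n)" for n
  define Z where "Z n \<omega> = d n \<omega> + m \<omega> * v \<omega>" for n \<omega>
  have d: "d n \<in> D k" for n by (simp add: d_def d')
  have dA: "d n \<in> A" "AE \<omega> in M. \<bar>d n \<omega>\<bar> \<le> real k" for n using d D by blast+
  have mvL: "(\<lambda>\<omega>. m \<omega> * v \<omega>) \<in> Linf M M" by (rule Linf_mult[OF G_Linf[OF mL] v_Linf])
  have ZL: "Z n \<in> Linf M M" for n
    unfolding Z_def by (rule Linf_add[OF Linf[OF dA(1)] mvL])
  obtain c where c: "AE \<omega> in M. \<bar>m \<omega> * v \<omega>\<bar> \<le> c" using Linf_bound[OF mvL] by metis
  have Z_bound: "AE \<omega> in M. \<bar>Z n \<omega>\<bar> \<le> real k + c" for n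
    using dA(2)[of n] c by eventually_elim (simp add: Z_def)
  have Z_lim: "AE \<omega> in M. (\<lambda>n. Z n \<omega>) \<longlonglongrightarrow> X \<omega>"
    using r(2)
  proof eventually_elim
    case (elim \<omega>)
    have "(\<lambda>n. X \<omega> - (X' \<omega> - d' (r n) \<omega>)) \<longlonglongrightarrow> X \<omega> - 0" by (intro tendsto_intros elim)
    then show ?case by (simp add: X'_def Z_def d_def algebra_simps)
  qed
  have "m \<in> shifts (Z n)" for n using mL dA(1) by (simp add: shifts_def Z_def)
  then have "AE \<omega> in M. \<forall>n. risk (Z n) \<omega> \<le> ereal (m \<omega>)"
    using risk_le[OF ZL] by (simp add: AE_all_countable)
  moreover have "AE \<omega> in M. \<forall>n. risk X \<omega> < ereal (- \<kappa>) \<longrightarrow> risk (Z n) \<omega> = - \<infinity>"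
    using \<kappa>[OF ZL] by (subst AE_all_countable) blast
  moreover have "AE \<omega> in M. risk X \<omega> \<le> liminf (\<lambda>n. risk (Z n) \<omega>)"
    by (rule risk_fatou[OF ZL Z_bound X Z_lim])
  ultimately have "AE \<omega> in M. risk X \<omega> = liminf (\<lambda>n. risk (Z n) \<omega>)"
    using m_eq
  proof eventually_elim
    case (elim \<omega>)
    \<comment> \<open>Below the threshold the left side is minus infinity; otherwise
      \<open>m \<omega>\<close> is the risk of X and bounds the left side.\<close>
    have "risk (Z n) \<omega> \<le> risk X \<omega>" for n
      using elim(1,2,4) by (cases "risk X \<omega> < ereal (- \<kappa>)") (auto simp: max_def not_less)
    then have "liminf (\<lambda>n. risk (Z n) \<omega>) \<le> liminf (\<lambda>n. risk X \<omega>)"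
      by (intro Liminf_mono always_eventually) simp
    then show ?case using elim(3) by (simp add: Liminf_const)
  qed
  then have "AE \<omega> in M. risk X \<omega> = liminf (\<lambda>n. risk (\<lambda>\<omega>. d n \<omega> + m \<omega> * v \<omega>) \<omega>)"
    by (simp add: Z_def[abs_def])
  from mL d Z_bound[unfolded Z_def] Z_lim[unfolded Z_def] this show thesis by (rule that)
qed

section \<open>Countable dense subsets and a supply of numeraires\<close>

text \<open>Separability passes to subsets of a metric space, although the given dense set may miss
  \<open>B\<close>: choose one point of \<open>B\<close> in every nonempty intersection of
  \<open>B\<close> with a small ball around a dense point. Halving the tolerance pays for the
  triangle inequality.\<close>

lemma separable_L1_subset:
  assumes sep: "separable_L1 M" and B: "B \<subseteq> L1 M"
  shows "\<exists>D. countable D \<and> D \<subseteq> B \<and>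
    (\<forall>Z\<in>B. \<forall>r>0. \<exists>W\<in>D. (\<integral>\<omega>. \<bar>Z \<omega> - W \<omega>\<bar> \<partial>M) < r)"
proof -
  obtain D0 where D0: "countable D0" "D0 \<subseteq> L1 M"
    "\<And>Z r. Z \<in> L1 M \<Longrightarrow> 0 < r \<Longrightarrow> \<exists>W\<in>D0. (\<integral>\<omega>. \<bar>Z \<omega> - W \<omega>\<bar> \<partial>M) < r"
    using sep unfolding separable_L1_def by metis
  define near where "near W n = {Z \<in> B. (\<integral>\<omega>. \<bar>Z \<omega> - W \<omega>\<bar> \<partial>M) < inverse (real (Suc n))}" for W n
  define pick where "pick p = (SOME Z. Z \<in> near (fst p) (snd p))" for p
  have pick: "pick (W, n) \<in> near W n" if "Z \<in> near W n" for Z W n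
    using someI[of "\<lambda>Z. Z \<in> near W n", OF that] by (simp add: pick_def)
  define I where "I = {p \<in> D0 \<times> UNIV. near (fst p) (snd p) \<noteq> {}}"
  have "countable I" unfolding I_def using D0(1) by (auto intro: countable_subset[of _ "D0 \<times> UNIV"])
  moreover have "pick ` I \<subseteq> B" using pick by (force simp: I_def near_def)
  moreover have "\<exists>W\<in>pick ` I. (\<integral>\<omega>. \<bar>Z \<omega> - W \<omega>\<bar> \<partial>M) < r" if Z: "Z \<in> B" and r: "0 < r" for Z r
  proof -
    obtain n where n: "inverse (real (Suc n)) < r / 2" using reals_Archimedean[of "r / 2"] r by auto
    obtain W where W: "W \<in> D0" "(\<integral>\<omega>. \<bar>Z \<omega> - W \<omega>\<bar> \<partial>M) < inverse (real (Suc n))"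
      using D0(3)[of Z "inverse (real (Suc n))"] Z B by auto
    define Z' where "Z' = pick (W, n)"
    have "Z \<in> near W n" using Z W by (simp add: near_def)
    then have Z': "Z' \<in> near W n" "Z' \<in> pick ` I"
      using pick W(1) by (auto simp: Z'_def I_def)
    have int: "integrable M Z" "integrable M Z'" "integrable M W"
      using Z Z'(1) B W(1) D0(2) by (auto simp: L1_def near_def)
    have "(\<integral>\<omega>. \<bar>Z \<omega> - Z' \<omega>\<bar> \<partial>M) \<le> (\<integral>\<omega>. \<bar>Z \<omega> - W \<omega>\<bar> + \<bar>Z' \<omega> - W \<omega>\<bar> \<partial>M)"
      using int by (intro integral_mono) auto
    also have "\<dots> = (\<integral>\<omega>. \<bar>Z \<omega> - W \<omega>\<bar> \<partial>M) + (\<integral>\<omega>. \<bar>Z' \<omega> - W \<omega>\<bar> \<partial>M)"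
      using int by (intro Bochner_Integration.integral_add) auto
    also have "\<dots> < r" using W(2) Z'(1) n by (simp add: near_def)
    finally show ?thesis using Z'(2) by blast
  qed
  ultimately show ?thesis by (intro exI[of _ "pick ` I"]) auto
qed

text \<open>One constant coefficient c/e serves at every date: X - (c/e) v is almost surely
  nonpositive and therefore accepted at each t.\<close>

lemma bounded_below_numeraire:
  assumes M: "prob_space M" and sub: "\<And>t. t \<le> T \<Longrightarrow> subalgebra M (F t)"
    and v: "v \<in> Linf M M" "0 < e" "AE \<omega> in M. e \<le> v \<omega>"
  shows "v \<in> numeraires M F T A"
proof -
  have "Linf M M = {\<lambda>\<omega>. X \<omega> + m \<omega> * v \<omega> | X m. X \<in> accept_at M F A t \<and> m \<in> Linf M (F t)}"
    (is "_ = ?S") if t: "t \<le> T" for t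
  proof (intro subset_antisym subsetI)
    fix X assume X: "X \<in> Linf M M"
    interpret conditional_acceptance M "F t" "accept_at M F A t"
      by (rule conditional_acceptance_accept_at[where F = F and t = t, OF M sub[OF t]])
    interpret numeraire_acceptance M "F t" "accept_at M F A t" v e
      by unfold_locales (fact v)+
    obtain c where "0 \<le> c" "AE \<omega> in M. \<bar>X \<omega>\<bar> \<le> c" using Linf_bound[OF X] by metis
    then have "(\<lambda>\<omega>. X \<omega> - c / e * v \<omega>) \<in> accept_at M F A t"
      using shifts_const[OF X] by (simp add: shifts_def)
    then show "X \<in> ?S"
      using Linf_const[of "c / e" M "F t"]
      by (intro CollectI exI[of _ "\<lambda>\<omega>. X \<omega> - c / e * v \<omega>"] exI[of _ "\<lambda>_. c / e"]) simp
  next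
    fix X assume "X \<in> ?S"
    then obtain W m where X: "X = (\<lambda>\<omega>. W \<omega> + m \<omega> * v \<omega>)"
      and W: "W \<in> Linf M M" and m: "m \<in> Linf M (F t)" by (auto simp: accept_at_def)
    show "X \<in> Linf M M"
      unfolding X by (intro Linf_add W Linf_mult Linf_subalgebra[OF sub[OF t] m] v(1))
  qed
  moreover have "AE \<omega> in M. 0 \<le> v \<omega>" using v(3) by eventually_elim (use v(2) in linarith)
  ultimately show ?thesis
    unfolding numeraires_def numeraires_at_def by (intro INT_I CollectI conjI v(1)) simp_all
qed

section \<open>The countable family of numeraires and the hedging sequences\<close>

theorem theorem7p26:
  fixes M :: "'a measure" and F :: "nat \<Rightarrow> 'a measure" and T :: nat
    and \<rho> :: "('a \<Rightarrow> real) \<Rightarrow> real"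
  assumes "prob_space M"
    and "T \<ge> 1"
    and "finite_horizon_filtration M F T"
    and "coherent_risk_measure M \<rho>"
    and "fatou_property M \<rho>"
    and "relevant M \<rho>"
    and "separable_L1 M"
  shows "countably_strongly_time_consistent M F T (acceptance_set M \<rho>)"
proof -
  define A where "A = acceptance_set M \<rho>"
  interpret prob_space M by fact
  have sub: "subalgebra M (F t)" if "t \<le> T" for t
    using assms(3) that by (simp add: finite_horizon_filtration_def)
  \<comment> \<open>Density is required in each norm ball separately, so that a bounded position is
    approximated under a single bound.\<close>
  define ball where "ball t k = {W \<in> accept_at M F A t. AE \<omega> in M. \<bar>W \<omega>\<bar> \<le> real k}" for t k
  have "ball t k \<subseteq> L1 M" for t k
    by (auto simp: ball_def accept_at_def L1_def intro: Linf_integrable)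
  then have "\<exists>D. countable D \<and> D \<subseteq> ball t k \<and>
      (\<forall>Z\<in>ball t k. \<forall>r>0. \<exists>W\<in>D. (\<integral>\<omega>. \<bar>Z \<omega> - W \<omega>\<bar> \<partial>M) < r)" for t k
    by (rule separable_L1_subset[OF assms(7)])
  then obtain D where D: "\<And>t k. countable (D t k)" "\<And>t k. D t k \<subseteq> ball t k"
    and dense: "\<And>t k Z r. Z \<in> ball t k \<Longrightarrow> 0 < r \<Longrightarrow> \<exists>W\<in>D t k. (\<integral>\<omega>. \<bar>Z \<omega> - W \<omega>\<bar> \<partial>M) < r"
    by metis
  \<comment> \<open>Adding \<open>real k + 1\<close> to an element of norm at most \<open>k\<close>
    gives a value of at least 1, so all members of \<open>U\<close> share the lower bound
    \<open>e = 1\<close>.\<close>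
  define U where "U = insert (\<lambda>_. 1) (\<Union>t k. (\<lambda>W \<omega>. W \<omega> + (real k + 1)) ` D t k)"
  have U: "v \<in> Linf M M \<and> (AE \<omega> in M. 1 \<le> v \<omega>)" if "v \<in> U" for v
  proof (cases "v = (\<lambda>_. 1)")
    case False
    then obtain t k W where W: "W \<in> D t k" and v: "v = (\<lambda>\<omega>. W \<omega> + (real k + 1))"
      using \<open>v \<in> U\<close> unfolding U_def by blast
    have WL: "W \<in> Linf M M" and bound: "AE \<omega> in M. \<bar>W \<omega>\<bar> \<le> real k"
      using W D(2) by (auto simp: ball_def accept_at_def)
    from bound have "AE \<omega> in M. 1 \<le> v \<omega>" unfolding v by eventually_elim simp
    then show ?thesis unfolding v by (intro conjI Linf_add[OF WL Linf_const])
  qed (simp add: Linf_const)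
  have "strongly_time_consistent M F T A U"
    unfolding strongly_time_consistent_def
  proof (intro ballI allI impI)
    fix v t X assume v: "v \<in> U" and t: "t < T" and X: "X \<in> Linf M M"
    interpret conditional_acceptance M "F t" "accept_at M F A t"
      by (rule conditional_acceptance_accept_at[where F = F and t = t, OF assms(1)]) (use sub t in simp)
    interpret numeraire_acceptance M "F t" "accept_at M F A t" v 1
      by unfold_locales (use U[OF v] in simp_all)
    have risk_eq: "cond_risk M F A v t Z = risk Z" for Z
      by (simp add: cond_risk_def risk_def shifts_def)
    obtain k m d c where m: "m \<in> Linf M (F t)" and d: "\<And>n. d n \<in> D t k"
      and bound: "\<And>n. AE \<omega> in M. \<bar>d n \<omega> + m \<omega> * v \<omega>\<bar> \<le> c"
      and lim: "AE \<omega> in M. (\<lambda>n. d n \<omega> + m \<omega> * v \<omega>) \<longlonglongrightarrow> X \<omega>"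
      and liminf: "AE \<omega> in M. risk X \<omega> = liminf (\<lambda>n. risk (\<lambda>\<omega>. d n \<omega> + m \<omega> * v \<omega>) \<omega>)"
      by (rule risk_approximation[OF X, of "D t"]) (use D dense in \<open>auto simp: ball_def\<close>)
    \<comment> \<open>Slot 1 holds cash, slot 2 the numeraire \<open>v\<close>, and slot
      \<open>i\<close> from 3 on the lifted \<open>d i\<close>. The n-th initial segment thus
      contains everything needed to form \<open>d n + m v\<close>.\<close>
    define V :: "nat \<Rightarrow> 'a \<Rightarrow> real" where "V i = (if i = 1 then (\<lambda>_. 1) else if i = 2 then v
      else (\<lambda>\<omega>. d i \<omega> + (real k + 1)))" for i
    \<comment> \<open>The coefficient \<open>- (real k + 1)\<close> on cash undoes the lift of
      \<open>d n\<close>. Vectors of length below 3 lack room for the three instruments, so the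
      first hedges are zero; this affects neither limits nor the liminf.\<close>
    define Y :: "nat \<Rightarrow> nat \<Rightarrow> 'a \<Rightarrow> real" where "Y n i = (if n < 3 then (\<lambda>_. 0)
      else if i = 1 then (\<lambda>_. - (real k + 1)) else if i = 2 then m
      else if i = n then (\<lambda>_. 1) else (\<lambda>_. 0))" for n i
    define Z where "Z n \<omega> = (\<Sum>i=1..n. Y n i \<omega> * V i \<omega>)" for n \<omega>
    have Z_small: "Z n = (\<lambda>_. 0)" if "n < 3" for n using that by (simp add: Z_def[abs_def] Y_def)
    have Z_large: "Z n = (\<lambda>\<omega>. d n \<omega> + m \<omega> * v \<omega>)" if n: "3 \<le> n" for n
    proof
      fix \<omega>
      have "Z n \<omega> = (\<Sum>i\<in>{1, 2, n}. Y n i \<omega> * V i \<omega>)"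
        unfolding Z_def using n by (intro sum.mono_neutral_right) (auto simp: Y_def)
      also have "\<dots> = d n \<omega> + m \<omega> * v \<omega>" using n by (simp add: Y_def V_def)
      finally show "Z n \<omega> = d n \<omega> + m \<omega> * v \<omega>" .
    qed
    have Y: "Y n i \<in> Linf M (F t)" for n i by (simp add: Y_def m Linf_const)
    have V: "V i \<in> U" for i using d v by (auto simp: V_def U_def)
    have ZL: "Z n \<in> Linf M M" for n
      unfolding Z_def using U V by (intro Linf_sum Linf_mult G_Linf[OF Y]) auto
    \<comment> \<open>The absolute value of \<open>c\<close> also covers the zero positions for
      \<open>n < 3\<close> without a separate proof that \<open>c\<close> is nonnegative.\<close>
    have Z_bound: "AE \<omega> in M. \<bar>Z n \<omega>\<bar> \<le> \<bar>c\<bar>" for n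
    proof (cases "n < 3")
      case False
      then show ?thesis using bound[of n] by (auto simp: Z_large elim!: eventually_mono)
    qed (simp add: Z_small)
    have Z_lim: "AE \<omega> in M. (\<lambda>n. Z n \<omega>) \<longlonglongrightarrow> X \<omega>"
      using lim
    proof eventually_elim
      case (elim \<omega>)
      show ?case
        by (rule Lim_transform_eventually[OF elim])
          (use eventually_ge_at_top[of 3] in eventually_elim, simp add: Z_large)
    qed
    have "weak_star_converges M Z X"
      unfolding weak_star_converges_def L1_def
    proof safe
      fix W :: "'a \<Rightarrow> real" assume W: "integrable M W"
      show "(\<lambda>n. \<integral>\<omega>. W \<omega> * Z n \<omega> \<partial>M) \<longlonglongrightarrow> (\<integral>\<omega>. W \<omega> * X \<omega> \<partial>M)"
      \<comment> \<open>The uniform bound turns almost sure convergence into convergence against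
        every integrable \<open>W\<close>.\<close>
      proof (rule integral_dominated_convergence[where w = "\<lambda>\<omega>. \<bar>W \<omega>\<bar> * \<bar>c\<bar>"])
        show "AE \<omega> in M. (\<lambda>n. W \<omega> * Z n \<omega>) \<longlonglongrightarrow> W \<omega> * X \<omega>"
          using Z_lim by eventually_elim (intro tendsto_intros)
        show "AE \<omega> in M. norm (W \<omega> * Z n \<omega>) \<le> \<bar>W \<omega>\<bar> * \<bar>c\<bar>" for n
          using Z_bound[of n] by eventually_elim (simp add: abs_mult mult_left_mono)
      qed (use W Linf_measurable[OF X] Linf_measurable[OF ZL] in auto)
    qed
    moreover have "(\<lambda>\<omega>. Z n \<omega> - (\<Sum>i=1..n. Y n i \<omega> * V i \<omega>)) \<in> accept_at M F A (t + 1)" for n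
    proof -
      interpret N: conditional_acceptance M "F (t + 1)" "accept_at M F A (t + 1)"
        by (rule conditional_acceptance_accept_at[where F = F and t = "t + 1", OF assms(1)])
          (use sub t in simp)
      show ?thesis using N.zero by (simp add: Z_def)
    qed
    moreover have "AE \<omega> in M. cond_risk M F A v t X \<omega> =
        liminf (\<lambda>n. cond_risk M F A v t (\<lambda>\<omega>'. \<Sum>i=1..n. Y n i \<omega>' * V i \<omega>') \<omega>)"
      using liminf
    proof eventually_elim
      case (elim \<omega>)
      have "liminf (\<lambda>n. risk (\<lambda>\<omega>. d n \<omega> + m \<omega> * v \<omega>) \<omega>) = liminf (\<lambda>n. risk (Z n) \<omega>)"
        by (rule Liminf_eq) (use eventually_ge_at_top[of 3] in eventually_elim, simp add: Z_large)
      with elim show ?case by (simp add: risk_eq Z_def[abs_def])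
    qed
    ultimately show "\<exists>(Xs :: nat \<Rightarrow> 'a \<Rightarrow> real) (Y :: nat \<Rightarrow> nat \<Rightarrow> 'a \<Rightarrow> real) (V :: nat \<Rightarrow> 'a \<Rightarrow> real).
          (\<forall>n\<ge>1. Xs n \<in> Linf M M) \<and>
          (\<forall>n\<ge>1. \<forall>i\<in>{1..n}. Y n i \<in> Linf M (F t)) \<and>
          (\<forall>i\<ge>1. V i \<in> U) \<and>
          weak_star_converges M Xs X \<and>
          (\<forall>n\<ge>1. (\<lambda>\<omega>. Xs n \<omega> - (\<Sum>i=1..n. Y n i \<omega> * V i \<omega>)) \<in> accept_at M F A (t + 1)) \<and>
          (AE \<omega> in M. cond_risk M F A v t X \<omega> =
             liminf (\<lambda>n. cond_risk M F A v t (\<lambda>\<omega>'. \<Sum>i=1..n. Y n i \<omega>' * V i \<omega>') \<omega>))"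
      using ZL Y V by (intro exI[of _ Z] exI[of _ Y] exI[of _ V]) blast
  qed
  moreover have "countable U" unfolding U_def using D(1) by (intro countable_insert countable_UN) auto
  moreover have "U \<noteq> {}" by (simp add: U_def)
  moreover have "U \<subseteq> numeraires M F T A"
  proof
    fix v assume "v \<in> U"
    from U[OF this] show "v \<in> numeraires M F T A"
      by (intro bounded_below_numeraire[where e = 1, OF assms(1)] sub) simp_all
  qed
  ultimately show ?thesis unfolding countably_strongly_time_consistent_def A_def by blast
qed

end
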